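(* Let $\mathcal G=\langle a,b,c,d\rangle$ be the first Grigorchuk group acting on the $2$-regular rooted tree $T$. The subgroup \[ W_T:=\bigl\langle a,\operatorname{diag}\bigl(\langle b,ac\rangle\times\langle b,ac\rangle^a\bigr)\bigr\rangle=\langle a,bab,cadab\rangle \] is a level-transitive weakly maximal subgroup of $\mathcal G$.
   Context: $T$ is the $2$-regular rooted tree (finite words over $\{0,1\}$) and $\operatorname{Aut}(T)$ the group of automorphisms fixing the root. For an automorphism $g$ fixing the first level we write $g=(g_0,g_1)$ if $g(iw)=i\,g_i(w)$. The first Grigorchuk group is $\mathcal G=\langle a,b,c,d\rangle\le\operatorname{Aut}(T)$, where $a(0w)=1w$, $a(1w)=0w$, and $b=(a,c)$, $c=(a,d)$, $d=(1,b)$. Here $\operatorname{diag}\bigl(\langle b,ac\rangle\times\langle b,ac\rangle^a\bigr)=\{(g,aga)\mid g\in\langle b,ac\rangle\}$. A subgroup of $\operatorname{Aut}(T)$ is level-transitive if it acts transitively on the set of vertices of each level. A subgroup of $\mathcal G$ is weakly maximal if it is maximal among the subgroups of infinite index of $\mathcal G$. *)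

theory Defs
  imports "HOL-Algebra.Generated_Groups"
begin

text \<open>
  Vertices of the \<open>2\<close>-regular rooted tree are the finite words over \<open>{0,1}\<close>, encoded as
  \<^typ>\<open>bool list\<close> with \<open>0 = False\<close> and \<open>1 = True\<close>; the root is the empty word.
\<close>

definition tree_edge :: "bool list \<Rightarrow> bool list \<Rightarrow> bool" where
  "tree_edge u v \<longleftrightarrow> (\<exists>x. v = u @ [x] \<or> u = v @ [x])"

definition tree_auts :: "(bool list \<Rightarrow> bool list) set" where
  "tree_auts = {f. bij f \<and> f [] = [] \<and> (\<forall>u v. tree_edge (f u) (f v) \<longleftrightarrow> tree_edge u v)}"

text \<open>
  The product is composition (left action). For right actions every word in the generators is
  reversed, i.e. replaced by its inverse since the generators are involutions, so the subgroups
  below do not depend on this convention.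
\<close>

definition Aut_T :: "(bool list \<Rightarrow> bool list) monoid" where
  "Aut_T = \<lparr>carrier = tree_auts, monoid.mult = (\<circ>), one = id\<rparr>"

text \<open>The automorphism \<open>(g0, g1)\<close>, sending \<open>0w\<close> to \<open>0 g0(w)\<close> and \<open>1w\<close> to \<open>1 g1(w)\<close>.\<close>

fun pair :: "(bool list \<Rightarrow> bool list) \<Rightarrow> (bool list \<Rightarrow> bool list) \<Rightarrow> bool list \<Rightarrow> bool list" where
  "pair g0 g1 [] = []"
| "pair g0 g1 (False # w) = False # g0 w"
| "pair g0 g1 (True # w) = True # g1 w"

fun gen_a :: "bool list \<Rightarrow> bool list" where
  "gen_a [] = []"
| "gen_a (x # w) = (\<not> x) # w"

fun gen_b gen_c gen_d :: "bool list \<Rightarrow> bool list" where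
  "gen_b [] = []"
| "gen_b (False # w) = False # gen_a w"
| "gen_b (True # w) = True # gen_c w"
| "gen_c [] = []"
| "gen_c (False # w) = False # gen_a w"
| "gen_c (True # w) = True # gen_d w"
| "gen_d [] = []"
| "gen_d (False # w) = False # w"
| "gen_d (True # w) = True # gen_b w"

lemma gen_pair:
  "gen_b = pair gen_a gen_c" "gen_c = pair gen_a gen_d" "gen_d = pair id gen_b"
proof -
  show "gen_b = pair gen_a gen_c"
  proof
    fix w show "gen_b w = pair gen_a gen_c w" by (cases "(gen_a, gen_c, w)" rule: pair.cases) auto
  qed
  show "gen_c = pair gen_a gen_d"
  proof
    fix w show "gen_c w = pair gen_a gen_d w" by (cases "(gen_a, gen_d, w)" rule: pair.cases) auto
  qed
  show "gen_d = pair id gen_b"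
  proof
    fix w show "gen_d w = pair id gen_b w" by (cases "(id :: bool list \<Rightarrow> bool list, gen_b, w)" rule: pair.cases) auto
  qed
qed

definition Grigorchuk :: "(bool list \<Rightarrow> bool list) monoid" where
  "Grigorchuk = subgroup_generated Aut_T {gen_a, gen_b, gen_c, gen_d}"

definition diag_set :: "(bool list \<Rightarrow> bool list) set" where
  "diag_set = {pair g (gen_a \<otimes>\<^bsub>Aut_T\<^esub> g \<otimes>\<^bsub>Aut_T\<^esub> gen_a) | g.
     g \<in> generate Aut_T {gen_b, gen_a \<otimes>\<^bsub>Aut_T\<^esub> gen_c}}"

definition W_T :: "(bool list \<Rightarrow> bool list) set" where
  "W_T = generate Aut_T (insert gen_a diag_set)"

definition level_transitive :: "(bool list \<Rightarrow> bool list) set \<Rightarrow> bool" where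
  "level_transitive H \<longleftrightarrow>
     (\<forall>n u v. length u = n \<longrightarrow> length v = n \<longrightarrow> (\<exists>h\<in>H. h u = v))"

definition weakly_maximal :: "('a, 'm) monoid_scheme \<Rightarrow> 'a set \<Rightarrow> bool" where
  "weakly_maximal G H \<longleftrightarrow>
     subgroup H G \<and> infinite (rcosets\<^bsub>G\<^esub> H) \<and>
     (\<forall>K. subgroup K G \<longrightarrow> infinite (rcosets\<^bsub>G\<^esub> K) \<longrightarrow> H \<subseteq> K \<longrightarrow> K = H)"

lemma tree_auts_comp: "f \<in> tree_auts \<Longrightarrow> g \<in> tree_auts \<Longrightarrow> f \<circ> g \<in> tree_auts"
  by (auto simp: tree_auts_def bij_comp)

lemma tree_auts_inv:
  assumes "f \<in> tree_auts"
  shows "inv_into UNIV f \<in> tree_auts"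
proof -
  have f: "bij f" "f [] = []" "\<And>u v. tree_edge (f u) (f v) \<longleftrightarrow> tree_edge u v"
    using assms by (auto simp: tree_auts_def)
  have "inv_into UNIV f [] = []"
    using f(1,2) by (metis bij_inv_eq_iff)
  moreover have "tree_edge (inv_into UNIV f u) (inv_into UNIV f v) \<longleftrightarrow> tree_edge u v" for u v
    using f(3)[of "inv_into UNIV f u" "inv_into UNIV f v"] f(1)
    by (simp add: bij_is_surj surj_f_inv_f)
  ultimately show ?thesis
    using f(1) by (simp add: tree_auts_def bij_imp_bij_inv)
qed

lemma group_Aut_T: "group Aut_T"
proof (rule groupI)
  fix f assume "f \<in> carrier Aut_T"
  then have f: "f \<in> tree_auts" by (simp add: Aut_T_def)
  then have "inj f" by (simp add: tree_auts_def bij_is_inj)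
  then have "inv_into UNIV f \<otimes>\<^bsub>Aut_T\<^esub> f = \<one>\<^bsub>Aut_T\<^esub>" by (simp add: Aut_T_def)
  moreover have "inv_into UNIV f \<in> carrier Aut_T"
    using tree_auts_inv[OF f] by (simp add: Aut_T_def)
  ultimately show "\<exists>g\<in>carrier Aut_T. g \<otimes>\<^bsub>Aut_T\<^esub> f = \<one>\<^bsub>Aut_T\<^esub>" by blast
next
  show "\<one>\<^bsub>Aut_T\<^esub> \<in> carrier Aut_T" by (simp add: Aut_T_def tree_auts_def)
qed (simp_all add: Aut_T_def tree_auts_comp comp_assoc)

lemma tree_edge_simps:
  "tree_edge [] v \<longleftrightarrow> length v = 1"
  "tree_edge v [] \<longleftrightarrow> length v = 1"
  "tree_edge (x # u) (y # v) \<longleftrightarrow> x = y \<and> tree_edge u v"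
  by (auto simp: tree_edge_def length_Suc_conv)

lemma tree_autI:
  assumes inv: "\<And>w. f (f w) = w"
    and len: "\<And>w. length (f w) = length w"
    and edge: "\<And>u v. tree_edge u v \<Longrightarrow> tree_edge (f u) (f v)"
  shows "f \<in> tree_auts"
proof -
  have "bij f" by (rule o_bij[of f]) (auto simp: inv)
  moreover have "f [] = []" using len[of "[]"] by simp
  moreover have "tree_edge (f u) (f v) \<longleftrightarrow> tree_edge u v" for u v
    using edge[of u v] edge[of "f u" "f v"] by (auto simp: inv)
  ultimately show ?thesis by (simp add: tree_auts_def)
qed

lemma length_gen_a [simp]: "length (gen_a w) = length w"
  by (cases w) auto

lemma length_gen_bcd [simp]:
  "length (gen_b w) = length w" "length (gen_c w) = length w" "length (gen_d w) = length w"
  by (induction w rule: gen_b_gen_c_gen_d.induct) auto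

lemma gen_a_gen_a [simp]: "gen_a (gen_a w) = w"
  by (cases w) auto

lemma gen_bcd_involution [simp]: "gen_b (gen_b w) = w" "gen_c (gen_c w) = w" "gen_d (gen_d w) = w"
  by (induction w rule: gen_b_gen_c_gen_d.induct) auto

lemma gen_a_edge: "tree_edge u v \<Longrightarrow> tree_edge (gen_a u) (gen_a v)"
  by (cases u; cases v) (auto simp: tree_edge_simps)

lemma gen_bcd_edge:
  "(tree_edge u v \<longrightarrow> tree_edge (gen_b u) (gen_b v)) \<and>
   (tree_edge u v \<longrightarrow> tree_edge (gen_c u) (gen_c v)) \<and>
   (tree_edge u v \<longrightarrow> tree_edge (gen_d u) (gen_d v))"
proof (induction u arbitrary: v)
  case Nil
  then show ?case by (simp add: tree_edge_simps)
next
  case (Cons x u)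
  show ?case
  proof (cases v)
    case Nil
    then show ?thesis by (simp add: tree_edge_simps del: gen_b.simps(2,3) gen_c.simps(2,3) gen_d.simps(2,3))
  next
    case v: (Cons y v')
    then show ?thesis using Cons.IH[of v'] gen_a_edge[of u v']
      by (cases x; cases y) (auto simp: tree_edge_simps)
  qed
qed

lemma gens_in_Aut_T: "{gen_a, gen_b, gen_c, gen_d} \<subseteq> carrier Aut_T"
  by (auto simp: Aut_T_def gen_a_edge gen_bcd_edge intro!: tree_autI)

lemma group_Grigorchuk: "group Grigorchuk"
  unfolding Grigorchuk_def by (rule group.group_subgroup_generated[OF group_Aut_T])

lemma carrier_Grigorchuk: "carrier Grigorchuk = generate Aut_T {gen_a, gen_b, gen_c, gen_d}"
  unfolding Grigorchuk_def carrier_subgroup_generated using gens_in_Aut_T by (simp add: Int_absorb1)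

end

theory Submission
  imports Defs
begin

text \<open>
  The group \<open>L = \<langle>b, ac\<rangle>\<close> is normal of index two in \<open>G\<close>, so \<open>W = D \<union> Da\<close> with
  \<open>D = {(g, aga) | g \<in> L}\<close>. Since the vertex stabilisers in \<open>L\<close> act on the subtrees as all of \<open>G\<close>,
  \<open>W\<close> is level-transitive; it has infinite index because it meets \<open>K \<times> 1\<close> trivially, where \<open>K\<close>
  is the normal closure of \<open>t = (ab)\<^sup>2\<close>, which is of finite index in \<open>G\<close> and contains \<open>K \<times> K\<close>.

  Let \<open>H\<close> properly contain \<open>W\<close>. Multiplying an element of \<open>H - W\<close> by elements of \<open>W\<close> gives either
  some \<open>(1, x)\<close> with \<open>x \<noteq> 1\<close>, or some \<open>(a, y)\<close>. In the latter case \<open>y \<noteq> a\<close>, as \<open>(a, a)\<close> is not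
  in \<open>G\<close>, and commutators with \<open>D\<close> yield \<open>(1, [g, ya])\<close> for all \<open>g \<in> L\<close>; as \<open>L\<close> has trivial
  centraliser, one of these is nontrivial. The group \<open>N\<close> of all \<open>x\<close> with \<open>(1, x) \<in> H\<close> is therefore
  nontrivial, and it is normalised by \<open>L\<close>. A double commutator puts a copy of \<open>t\<close> acting below some
  vertex into \<open>N\<close>, and conjugation by \<open>L\<close> spreads it to the product of copies of \<open>K\<close> over a whole
  level, which has finite index in \<open>G\<close>.
\<close>

section \<open>Tree automorphisms as plain functions\<close>

lemma mult_Aut_T [simp]: "f \<otimes>\<^bsub>Aut_T\<^esub> g = f \<circ> g"
  and one_Aut_T [simp]: "\<one>\<^bsub>Aut_T\<^esub> = id"
  and carrier_Aut_T [simp]: "carrier Aut_T = tree_auts"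
  by (simp_all add: Aut_T_def)

abbreviation finv :: "('a \<Rightarrow> 'b) \<Rightarrow> 'b \<Rightarrow> 'a" where
  "finv \<equiv> inv_into UNIV"

interpretation Aut_T: group Aut_T
  by (rule group_Aut_T)

lemma tree_auts_bij: "f \<in> tree_auts \<Longrightarrow> bij f"
  by (simp add: tree_auts_def)

lemma bij_inv_apply: "bij f \<Longrightarrow> f (finv f x) = x" "bij f \<Longrightarrow> finv f (f x) = x"
  by (simp_all add: bij_is_surj surj_f_inv_f bij_is_inj)

lemma comp_finv: "bij f \<Longrightarrow> f \<circ> finv f = id" "bij f \<Longrightarrow> finv f \<circ> f = id"
  by (auto simp: bij_is_surj surj_f_inv_f bij_is_inj)

lemma inv_Aut_T: "f \<in> tree_auts \<Longrightarrow> inv\<^bsub>Aut_T\<^esub> f = finv f"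
  by (rule Aut_T.inv_equality)
    (auto simp: tree_auts_inv tree_auts_bij bij_inv_apply)

lemma subgroup_Aut_T_iff:
  "subgroup S Aut_T \<longleftrightarrow> S \<subseteq> tree_auts \<and> id \<in> S \<and> (\<forall>f\<in>S. \<forall>g\<in>S. f \<circ> g \<in> S) \<and> (\<forall>f\<in>S. finv f \<in> S)"
  using inv_Aut_T by (auto simp: subgroup_def subset_iff)

lemma subgroup_Aut_T_D:
  assumes "subgroup S Aut_T"
  shows "id \<in> S" "f \<in> S \<Longrightarrow> g \<in> S \<Longrightarrow> f \<circ> g \<in> S" "f \<in> S \<Longrightarrow> finv f \<in> S"
    "f \<in> S \<Longrightarrow> f \<in> tree_auts" "f \<in> S \<Longrightarrow> bij f"
  using assms by (auto simp: subgroup_Aut_T_iff tree_auts_bij)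

lemma generate_Aut_T_subset:
  "X \<subseteq> S \<Longrightarrow> subgroup S Aut_T \<Longrightarrow> generate Aut_T X \<subseteq> S"
  by (rule Aut_T.generate_subgroup_incl)

lemma tree_auts_gens [simp]: "gen_a \<in> tree_auts" "gen_b \<in> tree_auts" "gen_c \<in> tree_auts" "gen_d \<in> tree_auts"
  using gens_in_Aut_T by auto

lemma tree_auts_id [simp]: "id \<in> tree_auts"
  by (simp add: tree_auts_def)

lemma gens_comp_self [simp]:
  "gen_a \<circ> gen_a = id" "gen_b \<circ> gen_b = id" "gen_c \<circ> gen_c = id" "gen_d \<circ> gen_d = id"
  by auto

lemma inv_gens [simp]: "finv gen_a = gen_a" "finv gen_b = gen_b" "finv gen_c = gen_c" "finv gen_d = gen_d"
  by (auto intro!: inv_unique_comp)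

lemma gens_mult:
  "gen_b (gen_c w) = gen_d w" "gen_c (gen_d w) = gen_b w" "gen_d (gen_b w) = gen_c w"
proof -
  have "gen_b (gen_c w) = gen_d w \<and> gen_c (gen_d w) = gen_b w \<and> gen_d (gen_b w) = gen_c w"
  proof (induction w)
    case (Cons x w)
    then show ?case by (cases x) auto
  qed simp
  then show "gen_b (gen_c w) = gen_d w" "gen_c (gen_d w) = gen_b w" "gen_d (gen_b w) = gen_c w"
    by auto
qed

lemma gens_mult':
  "gen_c (gen_b w) = gen_d w" "gen_d (gen_c w) = gen_b w" "gen_b (gen_d w) = gen_c w"
  by (metis gens_mult gen_bcd_involution)+

section \<open>Automorphisms acting below a vertex\<close>

lemma pair_comp: "pair f g \<circ> pair f' g' = pair (f \<circ> f') (g \<circ> g')"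
proof
  fix w show "(pair f g \<circ> pair f' g') w = pair (f \<circ> f') (g \<circ> g') w"
    by (cases "(f', g', w)" rule: pair.cases) auto
qed

lemma pair_id_id [simp]: "pair id id = id"
proof
  fix w show "pair id id w = id w"
    by (cases "(id :: bool list \<Rightarrow> bool list, id :: bool list \<Rightarrow> bool list, w)" rule: pair.cases) auto
qed

lemma gen_a_pair: "gen_a \<circ> pair f g \<circ> gen_a = pair g f"
proof
  fix w show "(gen_a \<circ> pair f g \<circ> gen_a) w = pair g f w"
    by (cases "(f, g, w)" rule: pair.cases) auto
qed

lemma pair_gen_a: "pair f g \<circ> gen_a = gen_a \<circ> pair g f"
  using gen_a_pair[of g f] by (metis comp_assoc comp_id gens_comp_self(1))

lemma pair_inject: "pair f g = pair f' g' \<longleftrightarrow> f = f' \<and> g = g'"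
proof
  assume eq: "pair f g = pair f' g'"
  have "f w = f' w" for w using fun_cong[OF eq, of "False # w"] by simp
  moreover have "g w = g' w" for w using fun_cong[OF eq, of "True # w"] by simp
  ultimately show "f = f' \<and> g = g'" by auto
qed simp

lemma pair_neq_swap: "pair f g \<noteq> pair f' g' \<circ> gen_a"
proof
  assume "pair f g = pair f' g' \<circ> gen_a"
  from fun_cong[OF this, of "[False]"] show False by simp
qed

lemma inv_pair:
  assumes "bij f" "bij g"
  shows "finv (pair f g) = pair (finv f) (finv g)"
  using assms by (intro inv_unique_comp) (simp_all add: pair_comp comp_finv)

lemma pair_in_tree_auts:
  assumes "f \<in> tree_auts" "g \<in> tree_auts"
  shows "pair f g \<in> tree_auts"
proof -
  have fg: "bij f" "bij g" "f [] = []" "g [] = []" using assms by (auto simp: tree_auts_def)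
  have "bij (pair f g)"
    by (rule o_bij[of "pair (finv f) (finv g)"])
      (use fg in \<open>simp_all add: pair_comp comp_finv\<close>)
  moreover have "tree_edge (pair f g u) (pair f g v) \<longleftrightarrow> tree_edge u v" for u v
  proof -
    have nil: "f w = [] \<longleftrightarrow> w = []" "g w = [] \<longleftrightarrow> w = []" for w
      using fg by (metis bij_inv_apply(2))+
    show ?thesis
      using assms by (cases "(f, g, u)" rule: pair.cases; cases "(f, g, v)" rule: pair.cases)
        (auto simp: tree_edge_simps tree_auts_def nil)
  qed
  ultimately show ?thesis by (simp add: tree_auts_def)
qed

text \<open>The embedding of the automorphism group into the rigid stabiliser of the vertex
  \<open>v\<close>: \<open>f\<close> acts on the subtree below \<open>v\<close>, all other vertices
  are fixed.\<close>

primrec at :: "bool list \<Rightarrow> (bool list \<Rightarrow> bool list) \<Rightarrow> bool list \<Rightarrow> bool list" where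
  "at [] f = f"
| "at (x # v) f = (if x then pair id (at v f) else pair (at v f) id)"

lemma at_append_arg [simp]: "at v f (v @ w) = v @ f w"
  by (induction v) auto

lemma at_outside:
  assumes "\<nexists>q. p = v @ q"
  shows "at v f p = p"
  using assms
proof (induction v arbitrary: p)
  case (Cons x v)
  then show ?case by (cases p) (auto, (metis (full_types) pair.simps id_apply)+)
qed simp

lemma at_at: "at u (at v f) = at (u @ v) f"
  by (induction u) auto

lemma at_id [simp]: "at v id = id"
  by (induction v) (simp_all only: at.simps pair_id_id if_cancel)

lemma at_comp: "at v (f \<circ> g) = at v f \<circ> at v g"
proof (induction v)
  case (Cons x v)
  show ?case
    by (cases x) (simp_all only: at.simps Cons.IH pair_comp id_o if_True if_False)
qed simp

lemma at_in_tree_auts: "f \<in> tree_auts \<Longrightarrow> at v f \<in> tree_auts"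
  by (induction v) (auto intro: pair_in_tree_auts)

lemma inv_at: "bij f \<Longrightarrow> finv (at v f) = at v (finv f)"
  by (rule inv_unique_comp) (simp_all add: comp_finv flip: at_comp)

lemma at_inj: "at v f = at v g \<Longrightarrow> f = g"
  by (metis at_append_arg ext same_append_eq)

lemma at_commute:
  "length v = length w \<Longrightarrow> v \<noteq> w \<Longrightarrow> at v f \<circ> at w g = at w g \<circ> at v f"
  by (induction v w rule: list_induct2) (auto simp: pair_comp)

text \<open>Vertices below \<open>u\<close> pull back under \<open>x\<close> to vertices below
  \<open>v\<close>, with \<open>y\<close> as coordinate change; all others pull back outside that
  subtree and are fixed. Every transport of a copy of \<open>gen_t\<close> from one vertex to
  another rests on this.\<close>

lemma conj_at:
  assumes x: "bij x" and xv: "\<And>q. x (v @ q) = u @ y (q)" and y: "bij y"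
  shows "x \<circ> at v f \<circ> finv x = at u (y \<circ> f \<circ> finv y)"
proof
  fix p
  show "(x \<circ> at v f \<circ> finv x) p = at u (y \<circ> f \<circ> finv y) p"
  proof (cases "\<exists>q. p = u @ q")
    case True
    then obtain q where p: "p = u @ q" by blast
    have "x (v @ finv y q) = p" using y by (simp add: xv p bij_inv_apply)
    then have "finv x p = v @ finv y q" using x by (metis bij_inv_apply(2))
    then show ?thesis by (simp add: p xv)
  next
    case False
    have "\<nexists>q. finv x p = v @ q"
    proof
      assume "\<exists>q. finv x p = v @ q"
      then show False using False x xv by (metis bij_inv_apply(1))
    qed
    then show ?thesis using x False by (simp add: at_outside bij_inv_apply)
  qed
qed

text \<open>As \<open>at v\<close> is a homomorphism, it suffices to check on generators that it
  maps a generated group into \<open>S\<close>.\<close>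

lemma subgroup_at_vimage:
  assumes S: "subgroup S Aut_T"
  shows "subgroup {f \<in> tree_auts. at v f \<in> S} Aut_T"
  unfolding subgroup_Aut_T_iff
proof (intro conjI ballI)
  fix f g assume "f \<in> {f \<in> tree_auts. at v f \<in> S}" "g \<in> {f \<in> tree_auts. at v f \<in> S}"
  then show "f \<circ> g \<in> {f \<in> tree_auts. at v f \<in> S}"
    using subgroup_Aut_T_D(2)[OF S] by (simp add: at_comp tree_auts_comp)
next
  fix f assume f: "f \<in> {f \<in> tree_auts. at v f \<in> S}"
  then have "finv (at v f) = at v (finv f)" by (simp add: inv_at tree_auts_bij)
  then show "finv f \<in> {f \<in> tree_auts. at v f \<in> S}"
    using f subgroup_Aut_T_D(3)[OF S] tree_auts_inv by force
qed (use subgroup_Aut_T_D(1)[OF S] in auto)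

lemma subgroup_conj_vimage:
  assumes S: "subgroup S Aut_T" and x: "x \<in> tree_auts"
  shows "subgroup {f \<in> tree_auts. x \<circ> f \<circ> finv x \<in> S} Aut_T"
  unfolding subgroup_Aut_T_iff
proof (intro conjI ballI)
  note bx = tree_auts_bij[OF x]
  let ?S = "{f \<in> tree_auts. x \<circ> f \<circ> finv x \<in> S}"
  show "id \<in> ?S" using subgroup_Aut_T_D(1)[OF S] by (simp add: comp_finv[OF bx])
  fix f assume f: "f \<in> ?S"
  have "finv (x \<circ> f \<circ> finv x) = x \<circ> finv f \<circ> finv x"
    using f bx by (simp add: o_inv_distrib bij_comp tree_auts_bij comp_assoc bij_imp_bij_inv inv_inv_eq)
  then show "finv f \<in> ?S"
    using f subgroup_Aut_T_D(3)[OF S] tree_auts_inv unfolding mem_Collect_eq by metis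
  fix g assume g: "g \<in> ?S"
  have "x \<circ> (f \<circ> g) \<circ> finv x = (x \<circ> f \<circ> finv x) \<circ> (x \<circ> g \<circ> finv x)"
    by (simp add: fun_eq_iff bij_inv_apply(2)[OF bx])
  then show "f \<circ> g \<in> ?S" using f g subgroup_Aut_T_D(2)[OF S] tree_auts_comp by auto
qed auto

section \<open>The Grigorchuk group and its subgroup of index two\<close>

abbreviation GG :: "(bool list \<Rightarrow> bool list) set" where
  "GG \<equiv> carrier Grigorchuk"

lemma generate_Aut_T_induct [consumes 1, case_names finv id step]:
  assumes g: "g \<in> generate Aut_T X"
    and X: "\<And>x. x \<in> X \<Longrightarrow> x \<in> tree_auts \<and> finv x \<in> X"
    and id: "P id"
    and step: "\<And>x g. x \<in> X \<Longrightarrow> g \<in> generate Aut_T X \<Longrightarrow> P g \<Longrightarrow> P (x \<circ> g)"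
  shows "P g"
proof -
  have X': "X \<subseteq> carrier Aut_T" using X by auto
  have sub: "subgroup (generate Aut_T X) Aut_T" by (rule Aut_T.generate_is_subgroup[OF X'])
  \<comment> \<open>The rule \<open>generate.induct\<close> splits products at arbitrary places, so
    the claim is strengthened to \<open>P (g \<circ> h)\<close> for every group element
    \<open>h\<close> with \<open>P h\<close>.\<close>
  from g have "\<forall>h. h \<in> generate Aut_T X \<longrightarrow> P h \<longrightarrow> P (g \<circ> h)"
  proof (induction rule: generate.induct)
    case one
    show ?case by (metis id_comp one_Aut_T)
  next
    case (incl x)
    then show ?case using step by metis
  next
    case (inv x)
    then show ?case using X[OF inv] step by (metis inv_Aut_T)
  next
    case (eng h1 h2)
    then show ?case by (metis comp_assoc mult_Aut_T subgroup.m_closed[OF sub])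
  qed
  from this[rule_format, of id] show ?thesis
    using id subgroup_Aut_T_D(1)[OF sub] by simp
qed

lemma subgroup_G: "subgroup GG Aut_T"
  unfolding carrier_Grigorchuk by (rule Aut_T.generate_is_subgroup[OF gens_in_Aut_T])

lemmas G_id = subgroup_Aut_T_D(1)[OF subgroup_G]
  and G_comp = subgroup_Aut_T_D(2)[OF subgroup_G]
  and G_finv = subgroup_Aut_T_D(3)[OF subgroup_G]
  and G_tree_auts = subgroup_Aut_T_D(4)[OF subgroup_G]
  and G_bij = subgroup_Aut_T_D(5)[OF subgroup_G]

lemma gens_in_G [simp]: "gen_a \<in> GG" "gen_b \<in> GG" "gen_c \<in> GG" "gen_d \<in> GG"
  unfolding carrier_Grigorchuk by (auto intro: generate.incl)

lemma gens_comp: "gen_b \<circ> gen_c = gen_d" "gen_c \<circ> gen_d = gen_b" "gen_d \<circ> gen_b = gen_c"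
    "gen_c \<circ> gen_b = gen_d" "gen_d \<circ> gen_c = gen_b" "gen_b \<circ> gen_d = gen_c"
  by (auto simp: gens_mult gens_mult')

text \<open>Since d = bc, a step for \<open>gen_d\<close> is a step for \<open>gen_c\<close>
  followed by one for \<open>gen_b\<close>.\<close>

lemma G_induct [consumes 1, case_names id a b c]:
  assumes g: "g \<in> GG"
    and id: "P id"
    and a: "\<And>g. g \<in> GG \<Longrightarrow> P g \<Longrightarrow> P (gen_a \<circ> g)"
    and b: "\<And>g. g \<in> GG \<Longrightarrow> P g \<Longrightarrow> P (gen_b \<circ> g)"
    and c: "\<And>g. g \<in> GG \<Longrightarrow> P g \<Longrightarrow> P (gen_c \<circ> g)"
  shows "P g"
proof -
  from g have "g \<in> generate Aut_T {gen_a, gen_b, gen_c, gen_d}" by (simp add: carrier_Grigorchuk)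
  then show ?thesis
  proof (induction rule: generate_Aut_T_induct)
    case (step x g)
    have g: "g \<in> GG" using step by (simp add: carrier_Grigorchuk)
    have "P (gen_d \<circ> g)"
      using b[OF G_comp[OF _ g] c[OF g step(3)]] by (simp add: gens_comp comp_assoc[symmetric])
    then show ?case using step(1,3) a b c g by blast
  next
    case (finv x)
    then show ?case by auto
  next
    case id
    show ?case by (rule assms(2))
  qed
qed

text \<open>Self-similarity of the group: the coordinates of \<open>gen_b\<close> and
  \<open>gen_c\<close> are again generators, and \<open>gen_a\<close> only swaps
  coordinates.\<close>

lemma G_pair_cases:
  assumes "g \<in> GG"
  shows "\<exists>g0\<in>GG. \<exists>g1\<in>GG. g = pair g0 g1 \<or> g = pair g0 g1 \<circ> gen_a"
  using assms
proof (induction rule: G_induct)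
  case id
  show ?case using G_id pair_id_id by metis
next
  case (a g)
  then show ?case by (metis comp_assoc gen_a_pair pair_gen_a)
next
  case (b g)
  then obtain g0 g1 where g: "g0 \<in> GG" "g1 \<in> GG" "g = pair g0 g1 \<or> g = pair g0 g1 \<circ> gen_a"
    by blast
  have "gen_b \<circ> pair g0 g1 = pair (gen_a \<circ> g0) (gen_c \<circ> g1)"
    by (simp add: gen_pair(1) pair_comp)
  then have "gen_b \<circ> g = pair (gen_a \<circ> g0) (gen_c \<circ> g1) \<or> gen_b \<circ> g = pair (gen_a \<circ> g0) (gen_c \<circ> g1) \<circ> gen_a"
    using g(3) by (metis comp_assoc)
  then show ?case using G_comp[OF gens_in_G(1) g(1)] G_comp[OF gens_in_G(3) g(2)] by blast
next
  case (c g)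
  then obtain g0 g1 where g: "g0 \<in> GG" "g1 \<in> GG" "g = pair g0 g1 \<or> g = pair g0 g1 \<circ> gen_a"
    by blast
  have "gen_c \<circ> pair g0 g1 = pair (gen_a \<circ> g0) (gen_d \<circ> g1)"
    by (simp add: gen_pair(2) pair_comp)
  then have "gen_c \<circ> g = pair (gen_a \<circ> g0) (gen_d \<circ> g1) \<or> gen_c \<circ> g = pair (gen_a \<circ> g0) (gen_d \<circ> g1) \<circ> gen_a"
    using g(3) by (metis comp_assoc)
  then show ?case using G_comp[OF gens_in_G(1) g(1)] G_comp[OF gens_in_G(4) g(2)] by blast
qed

lemma pair_in_GD: "pair x y \<in> GG \<Longrightarrow> x \<in> GG \<and> y \<in> GG"
  using G_pair_cases pair_neq_swap pair_inject by metis

lemma G_section: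
  assumes "g \<in> GG"
  shows "length (g v) = length v \<and> (\<exists>h\<in>GG. \<forall>w. g (v @ w) = g v @ h w)"
  using assms
proof (induction v arbitrary: g)
  case Nil
  then have "g [] = []" using G_tree_auts by (auto simp: tree_auts_def)
  with Nil show ?case by auto
next
  case (Cons x v)
  then obtain g0 g1 where g: "g0 \<in> GG" "g1 \<in> GG" "g = pair g0 g1 \<or> g = pair g0 g1 \<circ> gen_a"
    using G_pair_cases by blast
  show ?case
    using g(3) Cons.IH[OF g(1)] Cons.IH[OF g(2)] by (cases x) auto
qed

section \<open>The subgroup \<open>L_T\<close> and the sections of its elements\<close>

definition L_T :: "(bool list \<Rightarrow> bool list) set" where
  "L_T = generate Aut_T {gen_b, gen_a \<circ> gen_c}"

lemma L_gens_in_Aut_T: "{gen_b, gen_a \<circ> gen_c} \<subseteq> carrier Aut_T"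
  by (auto simp: tree_auts_comp)

lemma subgroup_L: "subgroup L_T Aut_T"
  unfolding L_T_def by (rule Aut_T.generate_is_subgroup[OF L_gens_in_Aut_T])

lemmas L_id = subgroup_Aut_T_D(1)[OF subgroup_L]
  and L_comp = subgroup_Aut_T_D(2)[OF subgroup_L]
  and L_finv = subgroup_Aut_T_D(3)[OF subgroup_L]
  and L_tree_auts = subgroup_Aut_T_D(4)[OF subgroup_L]
  and L_bij = subgroup_Aut_T_D(5)[OF subgroup_L]

lemma L_subset_G: "L_T \<subseteq> GG"
  unfolding L_T_def by (rule generate_Aut_T_subset[OF _ subgroup_G]) (auto intro: G_comp)

lemma b_in_L: "gen_b \<in> L_T" and ac_in_L: "gen_a \<circ> gen_c \<in> L_T"
  unfolding L_T_def by (auto intro: generate.incl)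

lemma ca_in_L: "gen_c \<circ> gen_a \<in> L_T"
proof -
  have "finv (gen_a \<circ> gen_c) = gen_c \<circ> gen_a" by (rule inv_unique_comp) auto
  then show ?thesis using L_finv[OF ac_in_L] by simp
qed

lemma aba_in_L: "gen_a \<circ> gen_b \<circ> gen_a \<in> L_T"
proof -
  have "(gen_a \<circ> gen_c) \<circ> gen_b \<circ> (gen_c \<circ> gen_a) = gen_a \<circ> gen_b \<circ> gen_a"
    by (simp add: fun_eq_iff gens_mult gens_mult')
  then show ?thesis using L_comp[OF L_comp[OF ac_in_L b_in_L] ca_in_L] by simp
qed

text \<open>Both a and c invert ac, c commutes with b, aba lies in \<open>L_T\<close>, and so does b
  itself.\<close>

lemma L_conj_gen:
  assumes s: "s \<in> {gen_a, gen_b, gen_c}" and l: "l \<in> L_T"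
  shows "s \<circ> l \<circ> s \<in> L_T"
proof -
  have s': "finv s = s" "s \<in> tree_auts" using s by auto
  have "generate Aut_T {gen_b, gen_a \<circ> gen_c} \<subseteq> {l \<in> tree_auts. s \<circ> l \<circ> finv s \<in> L_T}"
  proof (rule generate_Aut_T_subset[OF _ subgroup_conj_vimage[OF subgroup_L s'(2)]])
    have 1: "gen_c \<circ> gen_b \<circ> gen_c = gen_b"
      by (simp add: fun_eq_iff gens_mult gens_mult')
    have 2: "gen_a \<circ> (gen_a \<circ> gen_c) \<circ> gen_a = gen_c \<circ> gen_a"
      "gen_c \<circ> (gen_a \<circ> gen_c) \<circ> gen_c = gen_c \<circ> gen_a"
      by (simp_all add: fun_eq_iff)
    show "{gen_b, gen_a \<circ> gen_c} \<subseteq> {l \<in> tree_auts. s \<circ> l \<circ> finv s \<in> L_T}"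
      using s 1 2 aba_in_L b_in_L ac_in_L ca_in_L L_comp by (auto simp: tree_auts_comp)
  qed
  then show ?thesis using l s' by (auto simp: L_T_def)
qed

lemma conj_comp:
  "bij f \<Longrightarrow> bij g \<Longrightarrow> (f \<circ> g) \<circ> h \<circ> finv (f \<circ> g) = f \<circ> (g \<circ> h \<circ> finv g) \<circ> finv f"
  by (simp add: o_inv_distrib comp_assoc)

lemma L_normal:
  assumes "g \<in> GG" "l \<in> L_T"
  shows "g \<circ> l \<circ> finv g \<in> L_T"
  using assms
proof (induction rule: G_induct)
  case id
  then show ?case by simp
next
  case (a g)
  then show ?case
    using L_conj_gen[of gen_a] conj_comp[OF G_bij G_bij, of gen_a g] inv_gens(1) gens_in_G(1) insertI1
    by metis
next
  case (b g)
  then show ?case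
    using L_conj_gen[of gen_b] conj_comp[OF G_bij G_bij, of gen_b g] inv_gens(2) gens_in_G(2) insertI1 insertI2
    by metis
next
  case (c g)
  then show ?case
    using L_conj_gen[of gen_c] conj_comp[OF G_bij G_bij, of gen_c g] inv_gens(3) gens_in_G(3) insertI1 insertI2
    by metis
qed

text \<open>Left multiplication by a, b or c preserves the union of the two cosets, because b, aba,
  ac and ca lie in \<open>L_T\<close>.\<close>

lemma G_eq_L_cosets:
  assumes "g \<in> GG"
  shows "g \<in> L_T \<or> gen_a \<circ> g \<in> L_T"
  using assms
proof (induction rule: G_induct)
  case id
  show ?case using L_id by blast
next
  case (a g)
  then show ?case by (metis comp_assoc gens_comp_self(1) id_comp)
next
  case (b g)
  have "gen_a \<circ> (gen_b \<circ> g) = (gen_a \<circ> gen_b \<circ> gen_a) \<circ> (gen_a \<circ> g)" by (simp add: fun_eq_iff)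
  with b show ?case using L_comp aba_in_L b_in_L by metis
next
  case (c g)
  have "gen_c \<circ> g = (gen_c \<circ> gen_a) \<circ> (gen_a \<circ> g)" by (simp add: fun_eq_iff)
  with c show ?case using L_comp ca_in_L ac_in_L by (metis comp_assoc)
qed

text \<open>The elements b, aba and acac of \<open>L_T\<close> fix the vertex 0 and have sections a,
  c and da there. These give d, and then b = cd.\<close>

lemma L_sections_False:
  assumes "h \<in> GG"
  shows "\<exists>g\<in>L_T. \<forall>w. g (False # w) = False # h w"
proof -
  let ?R = "\<lambda>h. \<exists>g\<in>L_T. \<forall>w. g (False # w) = False # h w"
  have comp: "?R (f \<circ> g)" if fg: "?R f" "?R g" for f g
  proof -
    obtain f' g' where "f' \<in> L_T" "\<forall>w. f' (False # w) = False # f w"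
      "g' \<in> L_T" "\<forall>w. g' (False # w) = False # g w" using fg by blast
    then show ?thesis by (intro bexI[of _ "f' \<circ> g'"]) (auto intro: L_comp)
  qed
  have a: "?R gen_a" using b_in_L by (intro bexI[of _ gen_b]) auto
  have c: "?R gen_c" by (rule bexI[OF _ aba_in_L]) auto
  have "?R (gen_d \<circ> gen_a)"
    by (rule bexI[OF _ L_comp[OF ac_in_L ac_in_L]]) auto
  from comp[OF this a] have "?R gen_d" by (metis comp_assoc comp_id gens_comp_self(1))
  then have b: "?R gen_b" using comp[OF c] gens_comp(2) by metis
  show ?thesis using assms
  proof (induction rule: G_induct)
    case id
    show ?case by (rule bexI[OF _ L_id]) simp
  qed (blast intro: comp[OF a] comp[OF b] comp[OF c])+
qed

text \<open>
  The elements \<open>ca\<close> and \<open>ac\<close> of \<open>L\<close> move \<open>1\<close> to \<open>0\<close> and \<open>0\<close> to \<open>1\<close>, in both cases with section \<open>a\<close>.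
\<close>

lemma L_sections:
  assumes "h \<in> GG"
  shows "\<exists>g\<in>L_T. \<forall>w. g (i # w) = j # h w"
proof -
  let ?p = "\<lambda>i. if i then gen_a else id"
  have p: "?p i (?p i w) = w" for i w by simp
  have "?p j \<circ> h \<circ> ?p i \<in> GG" using assms by (simp add: G_comp G_id)
  then obtain g where g: "g \<in> L_T" "\<And>w. g (False # w) = False # ?p j (h (?p i w))"
    using L_sections_False by fastforce
  let ?l = "if j then gen_a \<circ> gen_c else id" and ?r = "if i then gen_c \<circ> gen_a else id"
  have "?l \<circ> g \<circ> ?r \<in> L_T" using g(1) ac_in_L ca_in_L L_id by (intro L_comp) auto
  moreover have "(?l \<circ> g \<circ> ?r) (i # w) = j # h w" for w
    by (cases i; cases j) (simp_all add: g(2))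
  ultimately show ?thesis by blast
qed

lemma G_move:
  assumes "length u = length w" "h \<in> GG"
  shows "\<exists>g\<in>GG. \<forall>x. g (u @ x) = w @ h x"
  using assms
proof (induction u w rule: list_induct2)
  case (Cons i u j w)
  then obtain g where g: "g \<in> GG" "\<And>x. g (u @ x) = w @ h x" by blast
  obtain g' where "g' \<in> L_T" "\<And>x. g' (i # x) = j # g x" using L_sections[OF g(1)] by blast
  then show ?case using g(2) L_subset_G by (intro bexI[of _ g']) auto
qed auto

text \<open>Only the first letter has to be moved by an element of \<open>L_T\<close>; its section
  may be any element of the whole group, and \<open>G_move\<close> handles the remaining
  letters.\<close>

lemma L_move:
  assumes "length u = length w" "u \<noteq> []" "h \<in> GG"
  shows "\<exists>g\<in>L_T. \<forall>x. g (u @ x) = w @ h x"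
proof -
  obtain i u' j w' where uw: "u = i # u'" "w = j # w'" "length u' = length w'"
    using assms(1,2) by (cases u; cases w) auto
  obtain g where g: "g \<in> GG" "\<And>x. g (u' @ x) = w' @ h x" using G_move[OF uw(3) assms(3)] by blast
  obtain g' where "g' \<in> L_T" "\<And>x. g' (i # x) = j # g x" using L_sections[OF g(1)] by blast
  then show ?thesis using g(2) by (intro bexI[of _ g']) (auto simp: uw)
qed

section \<open>The regular branch subgroup\<close>

definition gen_t :: "bool list \<Rightarrow> bool list" where
  "gen_t = gen_a \<circ> gen_b \<circ> gen_a \<circ> gen_b"

definition K_T :: "(bool list \<Rightarrow> bool list) set" where
  "K_T = generate Aut_T {g \<circ> gen_t \<circ> finv g | g. g \<in> GG}"

lemma t_in_G: "gen_t \<in> GG"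
  unfolding gen_t_def by (intro G_comp gens_in_G)

lemma t_in_L: "gen_t \<in> L_T"
  using L_comp[OF aba_in_L b_in_L] by (simp add: gen_t_def)

lemma finv_t: "finv gen_t = gen_b \<circ> gen_a \<circ> gen_b \<circ> gen_a"
  by (rule inv_unique_comp) (auto simp: gen_t_def)

lemma subgroup_K: "subgroup K_T Aut_T"
  unfolding K_T_def
  by (rule Aut_T.generate_is_subgroup) (use G_finv G_comp t_in_G G_tree_auts in auto)

lemmas K_id = subgroup_Aut_T_D(1)[OF subgroup_K]
  and K_comp = subgroup_Aut_T_D(2)[OF subgroup_K]
  and K_finv = subgroup_Aut_T_D(3)[OF subgroup_K]
  and K_tree_auts = subgroup_Aut_T_D(4)[OF subgroup_K]
  and K_bij = subgroup_Aut_T_D(5)[OF subgroup_K]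

lemma K_subset:
  assumes "subgroup S Aut_T" "\<And>g. g \<in> GG \<Longrightarrow> g \<circ> gen_t \<circ> finv g \<in> S"
  shows "K_T \<subseteq> S"
  unfolding K_T_def by (rule generate_Aut_T_subset) (use assms in auto)

lemma t_conj_in_K: "g \<in> GG \<Longrightarrow> g \<circ> gen_t \<circ> finv g \<in> K_T"
  unfolding K_T_def by (rule generate.incl) auto

lemma t_in_K: "gen_t \<in> K_T"
  using t_conj_in_K[OF G_id] by simp

lemma K_subset_L: "K_T \<subseteq> L_T"
  by (rule K_subset[OF subgroup_L]) (rule L_normal[OF _ t_in_L])

lemma K_subset_G: "K_T \<subseteq> GG"
  using K_subset_L L_subset_G by blast

lemma K_normal:
  assumes g: "g \<in> GG" and k: "k \<in> K_T"
  shows "g \<circ> k \<circ> finv g \<in> K_T"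
proof -
  have "K_T \<subseteq> {f \<in> tree_auts. g \<circ> f \<circ> finv g \<in> K_T}"
  proof (rule K_subset[OF subgroup_conj_vimage[OF subgroup_K G_tree_auts[OF g]]])
    fix h assume h: "h \<in> GG"
    have "g \<circ> (h \<circ> gen_t \<circ> finv h) \<circ> finv g \<in> K_T"
      using t_conj_in_K[OF G_comp[OF g h]] conj_comp[OF G_bij[OF g] G_bij[OF h]] by metis
    then show "h \<circ> gen_t \<circ> finv h \<in> {f \<in> tree_auts. g \<circ> f \<circ> finv g \<in> K_T}"
      using K_tree_auts[OF t_conj_in_K[OF h]] by simp
  qed
  then show ?thesis using k by auto
qed

text \<open>In coordinates t = (ca, ac) and ctc = (ac, dacd). The first coordinates cancel, and the
  second ones give a(cd)a(cd) = abab.\<close>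

lemma at_True_t: "at [True] gen_t = gen_t \<circ> (gen_c \<circ> gen_t \<circ> gen_c)"
proof
  fix w show "at [True] gen_t w = (gen_t \<circ> (gen_c \<circ> gen_t \<circ> gen_c)) w"
  proof (cases w)
    case (Cons x v)
    then show ?thesis by (cases x) (simp_all add: gen_t_def gens_mult gens_mult')
  qed (simp add: gen_t_def)
qed

text \<open>The branching property. Any \<open>h\<close> in the group is the section at the vertex 1
  of some element fixing that vertex, so conjugating (1, t) reaches every generator of
  \<open>K_T\<close> in the second coordinate.\<close>

lemma at_True_in_K:
  assumes "k \<in> K_T"
  shows "at [True] k \<in> K_T"
proof -
  have t: "at [True] gen_t \<in> K_T"
    using K_comp[OF t_in_K K_normal[OF gens_in_G(3) t_in_K]] by (simp only: at_True_t inv_gens)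
  have "K_T \<subseteq> {f \<in> tree_auts. at [True] f \<in> K_T}"
  proof (rule K_subset[OF subgroup_at_vimage[OF subgroup_K]])
    fix h assume h: "h \<in> GG"
    obtain g where g: "g \<in> GG" "\<And>x. g ([True] @ x) = [True] @ h x"
      using G_move[OF _ h, of "[True]" "[True]"] by blast
    have "g \<circ> at [True] gen_t \<circ> finv g = at [True] (h \<circ> gen_t \<circ> finv h)"
      using g h by (intro conj_at G_bij)
    then have "at [True] (h \<circ> gen_t \<circ> finv h) \<in> K_T" using K_normal[OF g(1) t] by metis
    then show "h \<circ> gen_t \<circ> finv h \<in> {f \<in> tree_auts. at [True] f \<in> K_T}"
      using K_tree_auts[OF t_conj_in_K[OF h]] by simp
  qed
  then show ?thesis using assms by auto
qed

lemma at_in_K: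
  assumes "k \<in> K_T"
  shows "at v k \<in> K_T"
proof (induction v)
  case (Cons x v)
  have 1: "pair id (at v k) \<in> K_T" using at_True_in_K[OF Cons] by simp
  have "pair (at v k) id \<in> K_T"
    using K_normal[OF gens_in_G(1) 1] by (simp only: inv_gens gen_a_pair)
  with 1 show ?case by simp
qed (use assms in simp)

lemma t_neq_id: "gen_t \<noteq> id"
proof
  assume "gen_t = id"
  from fun_cong[OF this, of "[False, False]"] show False by (simp add: gen_t_def)
qed

text \<open>On a finite \<open>K_T\<close> the injection sending k to (k, 1) would be onto, yet (1,
  t) is not in its image.\<close>

lemma infinite_K: "infinite K_T"
proof
  assume fin: "finite K_T"
  have "inj_on (at [False]) K_T" by (rule inj_onI) (rule at_inj)
  moreover have "at [False] ` K_T \<subseteq> K_T" using at_in_K by blast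
  ultimately have "at [False] ` K_T = K_T" using fin by (metis endo_inj_surj)
  moreover have "at [True] gen_t \<in> K_T" by (rule at_in_K[OF t_in_K])
  ultimately obtain k where "at [True] gen_t = at [False] k" by blast
  then have "gen_t = id" by (simp add: pair_inject)
  then show False using t_neq_id by simp
qed

section \<open>Centralisers and commutators of rigid elements\<close>

lemma moved_vertex:
  assumes "x \<noteq> (id :: bool list \<Rightarrow> bool list)"
  obtains v where "x v \<noteq> v"
  using assms by fastforce

text \<open>If \<open>z\<close> moves \<open>v\<close>, it carries the support of a copy of
  \<open>gen_t\<close> below \<open>v\<close> to a disjoint subtree, so it cannot commute with that
  copy.\<close>

lemma L_centralizer_trivial:
  assumes z: "z \<in> GG" "z \<noteq> id"
  shows "\<exists>l\<in>L_T. l \<circ> z \<noteq> z \<circ> l"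
proof -
  obtain v where v: "z v \<noteq> v" using z(2) by (rule moved_vertex)
  obtain q where q: "gen_t q \<noteq> q" using t_neq_id by (rule moved_vertex)
  obtain h where zv: "length (z v) = length v" "\<And>w. z (v @ w) = z v @ h w"
    using G_section[OF z(1), of v] by blast
  have "at v gen_t (z (v @ q)) = z (v @ q)"
    using v zv(1) by (intro at_outside) (auto simp: zv(2))
  moreover have "z (at v gen_t (v @ q)) \<noteq> z (v @ q)"
    using q bij_is_inj[OF G_bij[OF z(1)]] by (simp add: inj_eq)
  ultimately have "at v gen_t \<circ> z \<noteq> z \<circ> at v gen_t" by (metis comp_apply)
  then show ?thesis using at_in_K[OF t_in_K, of v] K_subset_L by blast
qed

text \<open>
  The usual double commutator: \<open>x\<close> moves \<open>v\<close>, so conjugation by \<open>x\<close> turns elements acting below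
  \<open>v\<close> into elements commuting with them.
\<close>

lemma commutator_at:
  assumes N: "subgroup N Aut_T" "N \<subseteq> GG"
    and norm: "\<And>l n. l \<in> L_T \<Longrightarrow> n \<in> N \<Longrightarrow> l \<circ> n \<circ> finv l \<in> N"
    and x: "x \<in> N" "x v \<noteq> v"
    and f: "f \<in> K_T" and g: "g \<in> K_T"
  shows "at v (finv f \<circ> g \<circ> f \<circ> finv g) \<in> N"
proof -
  have xG: "x \<in> GG" using x N by blast
  obtain h where h: "h \<in> GG" "length (x v) = length v" "\<And>w. x (v @ w) = x v @ h w"
    using G_section[OF xG, of v] by blast
  define e where "e = at (x v) (h \<circ> finv f \<circ> finv h)"
  have e: "x \<circ> at v (finv f) \<circ> finv x = e"
    unfolding e_def by (intro conj_at G_bij xG h)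
  have bij_e: "bij e"
    unfolding e_def
    by (intro tree_auts_bij at_in_tree_auts tree_auts_comp G_tree_auts[OF h(1)] tree_auts_inv K_tree_auts[OF f])
  have comm: "at v p \<circ> e = e \<circ> at v p" for p
    unfolding e_def using x(2) h(2) by (intro at_commute) auto
  define F where "F = at v f"
  define G where "G = at v g"
  have FG: "F \<in> L_T" "G \<in> L_T" using at_in_K f g K_subset_L unfolding F_def G_def by blast+
  have finv_FG: "finv F = at v (finv f)" "finv G = at v (finv g)"
    unfolding F_def G_def using f g by (simp_all add: inv_at K_bij)
  \<comment> \<open>The commutator of \<open>F\<close> and \<open>x\<close> is
    \<open>F \<circ> e\<close>, where \<open>e\<close> is supported below \<open>x v\<close>. A
    second commutator with \<open>G\<close> removes \<open>e\<close>, which commutes with everything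
    acting below \<open>v\<close>.\<close>
  have "F \<circ> x \<circ> finv F \<circ> finv x \<in> N"
    using norm[OF FG(1) x(1)] x(1) subgroup_Aut_T_D(2,3)[OF N(1)] by blast
  then have m: "F \<circ> e \<in> N" using e finv_FG(1) by (simp add: comp_assoc)
  have "finv (F \<circ> e) = finv F \<circ> finv e"
    using comm[of f] o_inv_distrib[OF bij_e L_bij[OF FG(1)]] unfolding F_def by simp
  then have "finv F \<circ> finv e \<in> N" using subgroup_Aut_T_D(3)[OF N(1) m] by simp
  then have "(finv F \<circ> finv e) \<circ> (G \<circ> (F \<circ> e) \<circ> finv G) \<in> N"
    using norm[OF FG(2) m] subgroup_Aut_T_D(2)[OF N(1)] by blast
  moreover have "G \<circ> (F \<circ> e) \<circ> finv G = e \<circ> at v (g \<circ> f \<circ> finv g)"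
  proof -
    have "G \<circ> (F \<circ> e) \<circ> finv G = (at v (g \<circ> f) \<circ> e) \<circ> at v (finv g)"
      by (simp add: finv_FG) (simp add: F_def G_def at_comp comp_assoc)
    also have "\<dots> = e \<circ> at v (g \<circ> f \<circ> finv g)"
      unfolding comm by (simp add: at_comp comp_assoc)
    finally show ?thesis .
  qed
  moreover have "(finv F \<circ> finv e) \<circ> (e \<circ> at v (g \<circ> f \<circ> finv g)) = at v (finv f \<circ> g \<circ> f \<circ> finv g)"
  proof -
    have "(finv F \<circ> finv e) \<circ> (e \<circ> at v (g \<circ> f \<circ> finv g)) = finv F \<circ> (finv e \<circ> e) \<circ> at v (g \<circ> f \<circ> finv g)"
      by (simp add: comp_assoc)
    also have "\<dots> = at v (finv f \<circ> g \<circ> f \<circ> finv g)"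
      unfolding comp_finv(2)[OF bij_e] finv_FG by (simp add: at_comp comp_assoc)
    finally show ?thesis .
  qed
  ultimately show ?thesis by simp
qed

section \<open>Parity of the number of swaps on a level\<close>

definition sec :: "bool \<Rightarrow> (bool list \<Rightarrow> bool list) \<Rightarrow> bool list \<Rightarrow> bool list" where
  "sec i g w = tl (g (i # w))"

primrec odd_swaps :: "nat \<Rightarrow> (bool list \<Rightarrow> bool list) \<Rightarrow> bool" where
  "odd_swaps 0 g \<longleftrightarrow> g [False] = [True]"
| "odd_swaps (Suc n) g \<longleftrightarrow> odd_swaps n (sec False g) \<noteq> odd_swaps n (sec True g)"

lemma sec_pair [simp]:
  "sec i (pair f g) = (if i then g else f)" "sec i (pair f g \<circ> gen_a) = (if i then f else g)"
  by (cases i; simp add: sec_def fun_eq_iff)+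

lemma sec_gens [simp]:
  "sec i gen_a = id" "sec i gen_b = (if i then gen_c else gen_a)"
  "sec i gen_c = (if i then gen_d else gen_a)" "sec i gen_d = (if i then gen_b else id)"
  "sec i id = id"
  by (cases i; simp add: sec_def fun_eq_iff)+

lemma odd_swaps_id [simp]: "\<not> odd_swaps n id"
proof (induction n)
  case (Suc n)
  then show ?case by (simp only: odd_swaps.simps sec_gens)
qed simp

text \<open>The sections of a product are products of sections, possibly with the two subtrees
  exchanged, and exclusive or does not see the exchange.\<close>

lemma odd_swaps_comp:
  assumes "f \<in> GG" "g \<in> GG"
  shows "odd_swaps n (f \<circ> g) \<longleftrightarrow> odd_swaps n f \<noteq> odd_swaps n g"
  using assms
proof (induction n arbitrary: f g)
  case 0
  obtain f0 f1 where f: "f = pair f0 f1 \<or> f = pair f0 f1 \<circ> gen_a"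
    and "f0 \<in> GG" "f1 \<in> GG" using G_pair_cases 0 by blast
  obtain g0 g1 where g: "g = pair g0 g1 \<or> g = pair g0 g1 \<circ> gen_a"
    and "g0 \<in> GG" "g1 \<in> GG" using G_pair_cases 0 by blast
  have "f [] = []" if "f \<in> GG" for f using G_tree_auts[OF that] by (simp add: tree_auts_def)
  note nil = this[OF \<open>f0 \<in> GG\<close>] this[OF \<open>f1 \<in> GG\<close>] this[OF \<open>g0 \<in> GG\<close>] this[OF \<open>g1 \<in> GG\<close>]
  show ?case using f g by (auto simp: nil)
next
  case (Suc n)
  obtain f0 f1 where f: "f = pair f0 f1 \<or> f = pair f0 f1 \<circ> gen_a"
    and fG: "f0 \<in> GG" "f1 \<in> GG" using G_pair_cases Suc.prems by blast
  obtain g0 g1 where g: "g = pair g0 g1 \<or> g = pair g0 g1 \<circ> gen_a"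
    and gG: "g0 \<in> GG" "g1 \<in> GG" using G_pair_cases Suc.prems by blast
  have swap: "pair f0 f1 \<circ> gen_a \<circ> pair g0 g1 = pair (f0 \<circ> g1) (f1 \<circ> g0) \<circ> gen_a"
    by (metis comp_assoc pair_comp pair_gen_a)
  have swap': "pair f0 f1 \<circ> gen_a \<circ> (pair g0 g1 \<circ> gen_a) = pair (f0 \<circ> g1) (f1 \<circ> g0)"
    by (metis comp_assoc pair_comp gen_a_pair)
  have noswap: "pair f0 f1 \<circ> (pair g0 g1 \<circ> gen_a) = pair (f0 \<circ> g0) (f1 \<circ> g1) \<circ> gen_a"
    by (simp add: pair_comp comp_assoc[symmetric])
  note IH = Suc.IH[OF fG(1) gG(1)] Suc.IH[OF fG(1) gG(2)] Suc.IH[OF fG(2) gG(1)] Suc.IH[OF fG(2) gG(2)]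
  show ?case
    using f g by (elim disjE; simp only: odd_swaps.simps swap swap' noswap pair_comp sec_pair IH if_True if_False; blast)
qed

text \<open>
  Among the generators, the parity on level \<open>0\<close> is odd for \<open>a\<close> only, and the sum of the parities on
  levels \<open>1\<close> and \<open>2\<close> is odd for \<open>c\<close> and \<open>d\<close> only; in \<open>b = (a, c)\<close>, \<open>c = (a, d)\<close> and
  \<open>d = (1, b)\<close> the two invariants of opposite sections agree.
\<close>

lemma G_sections_parity:
  assumes "g \<in> GG"
  shows "odd_swaps 0 (sec i g) \<longleftrightarrow> odd_swaps 1 (sec (\<not> i) g) \<noteq> odd_swaps 2 (sec (\<not> i) g)"
proof -
  define P where "P g \<longleftrightarrow> (\<forall>i. odd_swaps 0 (sec i g) = (odd_swaps 1 (sec (\<not> i) g) \<noteq> odd_swaps 2 (sec (\<not> i) g)))" for g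
  have step: "P (x \<circ> g)" if x: "x \<in> {gen_b, gen_c}" and g: "g \<in> GG" "P g" for x g
  proof -
    obtain x0 x1 where x': "x = pair x0 x1" "x0 \<in> GG" "x1 \<in> GG"
      using x gen_pair(1,2) gens_in_G by blast
    obtain g0 g1 where g': "g = pair g0 g1 \<or> g = pair g0 g1 \<circ> gen_a" "g0 \<in> GG" "g1 \<in> GG"
      using G_pair_cases[OF g(1)] by blast
    have Px: "P x" using x by (auto simp: P_def numeral_2_eq_2 all_bool_eq)
    \<comment> \<open>If \<open>g\<close> swaps the two subtrees, then \<open>x\<close> acts on the
      opposite one, hence the negated index.\<close>
    have sec: "sec i (x \<circ> g) = sec (if g = pair g0 g1 then i else \<not> i) x \<circ> sec i g" for i
    proof (cases "g = pair g0 g1")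
      case True
      then show ?thesis by (simp add: x' pair_comp)
    next
      case False
      then have "g = pair g0 g1 \<circ> gen_a" using g' by simp
      moreover have "x \<circ> (pair g0 g1 \<circ> gen_a) = pair (x0 \<circ> g0) (x1 \<circ> g1) \<circ> gen_a"
        by (simp add: x' pair_comp comp_assoc[symmetric])
      ultimately show ?thesis using False by (simp add: x')
    qed
    have "sec i x \<in> GG" "sec i g \<in> GG" for i using x' g' by auto
    note hom = odd_swaps_comp[OF this]
    show ?thesis
      unfolding P_def
    proof
      fix i
      define j where "j = (if g = pair g0 g1 then i else \<not> i)"
      have j: "(if g = pair g0 g1 then \<not> i else \<not> \<not> i) = (\<not> j)" by (simp add: j_def)
      show "odd_swaps 0 (sec i (x \<circ> g)) =
          (odd_swaps 1 (sec (\<not> i) (x \<circ> g)) \<noteq> odd_swaps 2 (sec (\<not> i) (x \<circ> g)))"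
        using Px[unfolded P_def, rule_format, of j] g(2)[unfolded P_def, rule_format, of i]
        unfolding sec[of i] sec[of "\<not> i"] j hom j_def[symmetric] by blast
    qed
  qed
  have "P g" using assms
  proof (induction rule: G_induct)
    case id
    have "P id" by (simp add: P_def)
    then show ?case .
  next
    case (a g)
    then obtain g0 g1 where g: "g = pair g0 g1 \<or> g = pair g0 g1 \<circ> gen_a" using G_pair_cases by blast
    \<comment> \<open>\<open>gen_a\<close> alters only the first letter of the image, which
      \<open>sec\<close> drops.\<close>
    have "sec i (gen_a \<circ> g) = sec i g" for i
    proof -
      have "gen_a \<circ> (pair g0 g1 \<circ> gen_a) = pair g1 g0" "gen_a \<circ> pair g0 g1 = pair g1 g0 \<circ> gen_a"
        by (metis gen_a_pair comp_assoc, metis pair_gen_a)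
      then show ?thesis using g by auto
    qed
    then show ?case using a unfolding P_def by simp
  next
    case (b g)
    then show ?case by (intro step) auto
  next
    case (c g)
    then show ?case by (intro step) auto
  qed
  then show ?thesis by (simp add: P_def)
qed

text \<open>The section a at 0 is odd on level 0, whereas the section a at 1 is even on levels 1 and
  2.\<close>

lemma pair_a_a_notin_G: "pair gen_a gen_a \<notin> GG"
proof
  assume "pair gen_a gen_a \<in> GG"
  from G_sections_parity[OF this, of False] show False by (simp add: numeral_2_eq_2)
qed

section \<open>Finite index\<close>

text \<open>
  Neither \<open>S\<close> nor \<open>R\<close> has to lie in \<open>GG\<close>: this lets the property pass from \<open>S\<close> to
  \<open>S \<times> S\<close>, which need not be contained in \<open>GG\<close>.
\<close>

definition finite_index_in_G :: "(bool list \<Rightarrow> bool list) set \<Rightarrow> bool" where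
  "finite_index_in_G S \<longleftrightarrow> (\<exists>R. finite R \<and> (\<forall>g\<in>GG. \<exists>s\<in>S. \<exists>r\<in>R. g = s \<circ> r))"

lemma finite_index_in_G_mono: "finite_index_in_G S \<Longrightarrow> S \<subseteq> S' \<Longrightarrow> finite_index_in_G S'"
  unfolding finite_index_in_G_def by (meson subsetD)

text \<open>The direct product of copies of \<open>S\<close>, one below each vertex of level
  n.\<close>

primrec level_prod :: "nat \<Rightarrow> (bool list \<Rightarrow> bool list) set \<Rightarrow> (bool list \<Rightarrow> bool list) set" where
  "level_prod 0 S = S"
| "level_prod (Suc n) S = {pair x y | x y. x \<in> level_prod n S \<and> y \<in> level_prod n S}"

lemma level_prod_subset:
  assumes "\<And>f g. f \<in> N \<Longrightarrow> g \<in> N \<Longrightarrow> f \<circ> g \<in> N"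
    and "\<And>(w :: bool list) k. length w = n \<Longrightarrow> k \<in> S \<Longrightarrow> at w k \<in> N"
  shows "level_prod n S \<subseteq> N"
  using assms
proof (induction n arbitrary: N)
  case 0
  then show ?case using 0(2)[of "[]"] by auto
next
  case (Suc n)
  \<comment> \<open>The induction hypothesis is applied to the preimage of \<open>N\<close> under
    \<open>at [i]\<close>, which is why \<open>N\<close> is kept arbitrary.\<close>
  have "level_prod n S \<subseteq> {f. at [i] f \<in> N}" for i
  proof (rule Suc.IH)
    fix w :: "bool list" and k assume "length w = n" "k \<in> S"
    then show "at w k \<in> {f. at [i] f \<in> N}" using Suc.prems(2)[of "i # w" k] by (simp add: at_at del: at.simps)
  next
    fix f g assume "f \<in> {f. at [i] f \<in> N}" "g \<in> {f. at [i] f \<in> N}"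
    then show "f \<circ> g \<in> {f. at [i] f \<in> N}"
      unfolding mem_Collect_eq at_comp by (rule Suc.prems(1))
  qed
  from this[of True] this[of False] have
    "pair id x \<in> N" "pair x id \<in> N" if "x \<in> level_prod n S" for x using that by auto
  then have "pair x y \<in> N" if "x \<in> level_prod n S" "y \<in> level_prod n S" for x y
    using Suc.prems(1)[of "pair x id" "pair id y"] that by (simp add: pair_comp)
  then show ?case by auto
qed

text \<open>Factor both coordinates separately; the new representatives are the pairs of old ones,
  with or without a final \<open>gen_a\<close>.\<close>

lemma finite_index_level_prod: "finite_index_in_G S \<Longrightarrow> finite_index_in_G (level_prod n S)"
proof (induction n)
  case (Suc n)
  then obtain R where R: "finite R" "\<And>g. g \<in> GG \<Longrightarrow> \<exists>s\<in>level_prod n S. \<exists>r\<in>R. g = s \<circ> r"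
    unfolding finite_index_in_G_def by blast
  define R' where "R' = (\<lambda>(x, y). pair x y) ` (R \<times> R) \<union> (\<lambda>(x, y). pair x y \<circ> gen_a) ` (R \<times> R)"
  have "\<exists>s\<in>level_prod (Suc n) S. \<exists>r\<in>R'. g = s \<circ> r" if g: "g \<in> GG" for g
  proof -
    obtain g0 g1 where g': "g0 \<in> GG" "g1 \<in> GG" "g = pair g0 g1 \<or> g = pair g0 g1 \<circ> gen_a"
      using G_pair_cases[OF g] by blast
    obtain s0 r0 s1 r1 where sr: "s0 \<in> level_prod n S" "r0 \<in> R" "g0 = s0 \<circ> r0"
      "s1 \<in> level_prod n S" "r1 \<in> R" "g1 = s1 \<circ> r1"
      using R(2) g' by meson
    have "pair s0 s1 \<in> level_prod (Suc n) S" using sr by auto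
    moreover have "pair r0 r1 \<in> R'" "pair r0 r1 \<circ> gen_a \<in> R'" using sr unfolding R'_def by auto
    moreover have "g = pair s0 s1 \<circ> pair r0 r1 \<or> g = pair s0 s1 \<circ> (pair r0 r1 \<circ> gen_a)"
      using g'(3) unfolding sr comp_assoc[symmetric] pair_comp .
    ultimately show ?thesis by blast
  qed
  moreover have "finite R'" using R(1) unfolding R'_def by simp
  ultimately show ?case unfolding finite_index_in_G_def by blast
qed simp

text \<open>b commutes with c, its commutator with a is the inverse of t, and normality of
  \<open>K_T\<close> carries this along any word.\<close>

lemma b_central_mod_K: "q \<in> GG \<Longrightarrow> gen_b \<circ> q \<circ> gen_b \<circ> finv q \<in> K_T"
proof (induction rule: G_induct)
  case id
  have "gen_b \<circ> id \<circ> gen_b \<circ> finv id \<in> K_T" using K_id by simp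
  then show ?case .
next
  case (a q)
  have eq: "gen_b \<circ> (gen_a \<circ> q) \<circ> gen_b \<circ> finv (gen_a \<circ> q)
      = finv gen_t \<circ> (gen_a \<circ> (gen_b \<circ> q \<circ> gen_b \<circ> finv q) \<circ> gen_a)"
    using G_bij[OF a(1)] by (simp add: o_inv_distrib tree_auts_bij finv_t) (simp add: fun_eq_iff)
  show ?case unfolding eq
    using K_normal[OF gens_in_G(1) a(2)] K_finv[OF t_in_K] K_comp by (simp only: inv_gens)
next
  case (b q)
  have eq: "gen_b \<circ> (gen_b \<circ> q) \<circ> gen_b \<circ> finv (gen_b \<circ> q)
      = gen_b \<circ> (gen_b \<circ> q \<circ> gen_b \<circ> finv q) \<circ> gen_b"
    using G_bij[OF b(1)] by (simp add: o_inv_distrib tree_auts_bij) (simp add: fun_eq_iff)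
  show ?case unfolding eq using K_normal[OF gens_in_G(2) b(2)] by (simp only: inv_gens)
next
  case (c q)
  have eq: "gen_b \<circ> (gen_c \<circ> q) \<circ> gen_b \<circ> finv (gen_c \<circ> q)
      = gen_c \<circ> (gen_b \<circ> q \<circ> gen_b \<circ> finv q) \<circ> gen_c"
    using G_bij[OF c(1)] by (simp add: o_inv_distrib tree_auts_bij) (simp add: fun_eq_iff gens_mult gens_mult')
  show ?case unfolding eq using K_normal[OF gens_in_G(3) c(2)] by (simp only: inv_gens)
qed

text \<open>ada = (b, 1) and d = (1, b) commute.\<close>

lemma ad_power4: "gen_d \<circ> gen_a \<circ> gen_d \<circ> gen_a = gen_a \<circ> gen_d \<circ> gen_a \<circ> gen_d"
proof
  fix w show "(gen_d \<circ> gen_a \<circ> gen_d \<circ> gen_a) w = (gen_a \<circ> gen_d \<circ> gen_a \<circ> gen_d) w"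
  proof (cases w)
    case (Cons x v)
    then show ?thesis by (cases x) simp_all
  qed simp
qed

text \<open>
  Modulo \<open>K\<close> the involution \<open>b\<close> is central, and \<open>a\<close>, \<open>d\<close> generate a dihedral group of order \<open>8\<close>.
\<close>

lemma finite_index_K: "finite_index_in_G K_T"
proof -
  define Q where "Q = {id, gen_a, gen_d, gen_a \<circ> gen_d, gen_d \<circ> gen_a, gen_a \<circ> gen_d \<circ> gen_a,
    gen_d \<circ> gen_a \<circ> gen_d, gen_a \<circ> gen_d \<circ> gen_a \<circ> gen_d}"
  \<comment> \<open>Candidate representatives: the dihedral elements \<open>Q\<close>, each with or
    without b on the right. Modulo \<open>K_T\<close> they are stable under left multiplication by
    a, d and b.\<close>
  define R where "R = Q \<union> (\<lambda>q. q \<circ> gen_b) ` Q"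
  define P where "P g \<longleftrightarrow> (\<exists>k\<in>K_T. \<exists>r\<in>R. g = k \<circ> r)" for g
  have QG: "Q \<subseteq> GG" unfolding Q_def using G_id G_comp gens_in_G by simp
  have aa: "gen_a \<circ> (gen_a \<circ> f) = f" "gen_b \<circ> (gen_b \<circ> f) = f" "gen_d \<circ> (gen_d \<circ> f) = f" for f
    by (simp_all add: fun_eq_iff)
  have dada: "gen_d \<circ> (gen_a \<circ> (gen_d \<circ> gen_a)) = gen_a \<circ> (gen_d \<circ> (gen_a \<circ> gen_d))"
    using ad_power4 by (simp add: comp_assoc)
  have "gen_d \<circ> (gen_a \<circ> (gen_d \<circ> (gen_a \<circ> gen_d))) = gen_d \<circ> (gen_d \<circ> (gen_a \<circ> (gen_d \<circ> gen_a)))"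
    by (simp only: dada)
  then have dadad: "gen_d \<circ> (gen_a \<circ> (gen_d \<circ> (gen_a \<circ> gen_d))) = gen_a \<circ> (gen_d \<circ> gen_a)"
    by (simp only: aa)
  have Qa: "gen_a \<circ> q \<in> Q" if "q \<in> Q" for q
    using that unfolding Q_def by (elim insertE emptyE; simp add: comp_assoc aa)
  have Qd: "gen_d \<circ> q \<in> Q" if "q \<in> Q" for q
    using that unfolding Q_def by (elim insertE emptyE; simp add: comp_assoc aa dada dadad)
  have conj: "s \<circ> (k \<circ> r) = (s \<circ> k \<circ> s) \<circ> (s \<circ> r)" "s \<circ> k \<circ> s \<in> K_T"
    if s: "s \<in> {gen_a, gen_b, gen_d}" and k: "k \<in> K_T" for s k r
  proof -
    show "s \<circ> (k \<circ> r) = (s \<circ> k \<circ> s) \<circ> (s \<circ> r)" using s by (elim insertE emptyE) (simp_all add: fun_eq_iff)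
    have "finv s = s" "s \<in> GG" using s by auto
    then show "s \<circ> k \<circ> s \<in> K_T" using K_normal[OF _ k, of s] by simp
  qed
  have P_ad: "P (s \<circ> g)" if s: "s \<in> {gen_a, gen_d}" and "P g" for s g
  proof -
    obtain k r where kr: "k \<in> K_T" "r \<in> R" "g = k \<circ> r" using \<open>P g\<close> unfolding P_def by blast
    have "s \<circ> r \<in> R" using kr(2) s Qa Qd unfolding R_def by (auto simp: comp_assoc[symmetric])
    then show ?thesis unfolding P_def kr(3) using conj(1)[of s k r] conj(2)[of s k] s kr(1) by blast
  qed
  have P_b: "P (gen_b \<circ> g)" if "P g" for g
  proof -
    obtain k r where kr: "k \<in> K_T" "r \<in> R" "g = k \<circ> r" using \<open>P g\<close> unfolding P_def by blast
    then obtain q where q: "q \<in> Q" "r = q \<or> r = q \<circ> gen_b" unfolding R_def by blast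
    let ?k = "gen_b \<circ> q \<circ> gen_b \<circ> finv q"
    have bij: "bij q" using q(1) QG G_bij by blast
    have "?k \<in> K_T" using q(1) QG by (intro b_central_mod_K) blast
    \<comment> \<open>Moving b past \<open>q\<close> to the right costs only the factor
      \<open>?k\<close> from \<open>K_T\<close>.\<close>
    moreover have "gen_b \<circ> q = ?k \<circ> (q \<circ> gen_b)" "gen_b \<circ> (q \<circ> gen_b) = ?k \<circ> q"
      by (simp_all add: fun_eq_iff bij_inv_apply(2)[OF bij])
    ultimately obtain r' where r': "r' \<in> R" "gen_b \<circ> r = ?k \<circ> r'" using q unfolding R_def by blast
    have "gen_b \<circ> g = ((gen_b \<circ> k \<circ> gen_b) \<circ> ?k) \<circ> r'"
      using conj(1)[of gen_b k r] kr r' by (simp add: comp_assoc)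
    moreover have "(gen_b \<circ> k \<circ> gen_b) \<circ> ?k \<in> K_T"
      using \<open>?k \<in> K_T\<close> conj(2)[of gen_b k] kr(1) by (intro K_comp[of _ ?k]) blast+
    ultimately show ?thesis unfolding P_def using r'(1) by blast
  qed
  have "P g" if "g \<in> GG" for g
    using that
  proof (induction rule: G_induct)
    case id
    have "id \<in> R" unfolding R_def Q_def by blast
    then show ?case unfolding P_def using K_id by (metis comp_id)
  next
    case (a g)
    then show ?case by (intro P_ad) auto
  next
    case (b g)
    then show ?case by (intro P_b)
  next
    case (c g)
    have "P (gen_b \<circ> (gen_d \<circ> g))" using c(2) by (intro P_b P_ad) auto
    then show ?case by (simp only: comp_assoc[symmetric] gens_comp)
  qed
  moreover have "finite R" unfolding R_def Q_def by simp
  ultimately show ?thesis unfolding finite_index_in_G_def P_def by blast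
qed

text \<open>In coordinates dtd = (ca, bacb) and the inverse of t is (ac, ca). The product is (1,
  ba(cbc)a) = (1, baba).\<close>

lemma d_t_commutator: "gen_d \<circ> gen_t \<circ> gen_d \<circ> finv gen_t = at [True] (finv gen_t)"
proof
  fix w show "(gen_d \<circ> gen_t \<circ> gen_d \<circ> finv gen_t) w = at [True] (finv gen_t) w"
  proof (cases w)
    case (Cons x v)
    then show ?thesis
      unfolding finv_t by (cases x) (simp_all add: gen_t_def gens_mult gens_mult')
  qed (simp add: finv_t, simp add: gen_t_def)
qed

text \<open>
  The commutator of \<open>c\<close> and \<open>t\<^sup>-\<^sup>1\<close> has section \<open>d\<close> at \<open>1111\<close>, and \<open>[d, t]\<close> is \<open>t\<^sup>-\<^sup>1\<close>
  acting below \<open>1\<close>; hence a double commutator of elements of \<open>K\<close> gives back \<open>t\<close> itself.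
\<close>

lemma t_in_double_commutator:
  assumes N: "subgroup N Aut_T" "N \<subseteq> GG"
    and norm: "\<And>l n. l \<in> L_T \<Longrightarrow> n \<in> N \<Longrightarrow> l \<circ> n \<circ> finv l \<in> N"
    and x: "x \<in> N" "x v \<noteq> v"
  shows "at (v @ replicate 5 True) gen_t \<in> N"
proof -
  define p where "p = (gen_c \<circ> finv gen_t \<circ> gen_c) \<circ> gen_t"
  define u where "u = replicate 4 True"
  have p: "p \<in> K_T"
    using K_normal[OF gens_in_G(3) K_finv[OF t_in_K]] t_in_K K_comp unfolding p_def by simp
  have "p (u @ q) = u @ gen_d q" for q
    unfolding p_def finv_t by (simp add: u_def gen_t_def numeral_eq_Suc gens_mult gens_mult')
  then have "p \<circ> at u gen_t \<circ> finv p = at u (gen_d \<circ> gen_t \<circ> finv gen_d)"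
    by (intro conj_at K_bij[OF p] G_bij gens_in_G)
  then have "p \<circ> at u gen_t \<circ> finv p \<circ> finv (at u gen_t) = at u (gen_d \<circ> gen_t \<circ> gen_d \<circ> finv gen_t)"
    by (simp add: inv_at[OF K_bij[OF t_in_K]] at_comp)
  also have "\<dots> = at (u @ [True]) (finv gen_t)"
    by (simp only: d_t_commutator at_at)
  finally have eq: "p \<circ> at u gen_t \<circ> finv p \<circ> finv (at u gen_t) = at (u @ [True]) (finv gen_t)" .
  \<comment> \<open>\<open>commutator_at\<close> is used with \<open>f = finv p\<close>, so that
    \<open>p\<close> itself stands in front as in \<open>eq\<close>.\<close>
  have "at v (finv (finv p) \<circ> at u gen_t \<circ> finv p \<circ> finv (at u gen_t)) \<in> N"
    by (rule commutator_at[OF N norm x K_finv[OF p] at_in_K[OF t_in_K]])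
  then have "at (v @ u @ [True]) (finv gen_t) \<in> N"
    by (simp only: inv_inv_eq[OF K_bij[OF p]] eq at_at)
  moreover have "u @ [True] = replicate 5 True" by (simp add: u_def numeral_eq_Suc)
  ultimately have "at (v @ replicate 5 True) (finv gen_t) \<in> N" by simp
  then show ?thesis
    using subgroup_Aut_T_D(3)[OF N(1)] inv_at[OF K_bij[OF K_finv[OF t_in_K]]]
      inv_inv_eq[OF K_bij[OF t_in_K]] by metis
qed

text \<open>One copy of t below \<open>u\<close> suffices: \<open>L_T\<close> carries
  \<open>u\<close> to any vertex \<open>w\<close> of its level with any prescribed section, so all
  conjugates of t appear below \<open>w\<close>.\<close>

lemma level_prod_in_normalized:
  assumes N: "subgroup N Aut_T" "N \<subseteq> GG"
    and norm: "\<And>l n. l \<in> L_T \<Longrightarrow> n \<in> N \<Longrightarrow> l \<circ> n \<circ> finv l \<in> N"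
    and x: "x \<in> N" "x \<noteq> id"
  shows "\<exists>n. level_prod n K_T \<subseteq> N"
proof -
  obtain v where v: "x v \<noteq> v" using x(2) by (rule moved_vertex)
  define u where "u = v @ replicate 5 True"
  have u: "at u gen_t \<in> N" "u \<noteq> []"
    using t_in_double_commutator[OF N norm x(1) v] unfolding u_def by simp_all
  have "at w k \<in> N" if w: "length w = length u" and k: "k \<in> K_T" for w k
  proof -
    have "K_T \<subseteq> {f \<in> tree_auts. at w f \<in> N}"
    proof (rule K_subset[OF subgroup_at_vimage[OF N(1)]])
      fix h assume h: "h \<in> GG"
      obtain l where l: "l \<in> L_T" "\<And>q. l (u @ q) = w @ h q"
        using L_move[OF w[symmetric] u(2) h] by blast
      have "l \<circ> at u gen_t \<circ> finv l = at w (h \<circ> gen_t \<circ> finv h)"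
        by (rule conj_at[OF L_bij[OF l(1)] l(2) G_bij[OF h]])
      then have "at w (h \<circ> gen_t \<circ> finv h) \<in> N" using norm[OF l(1) u(1)] by simp
      then show "h \<circ> gen_t \<circ> finv h \<in> {f \<in> tree_auts. at w f \<in> N}"
        using K_tree_auts[OF t_conj_in_K[OF h]] by simp
    qed
    then show ?thesis using k by auto
  qed
  then have "level_prod (length u) K_T \<subseteq> N"
    using subgroup_Aut_T_D(2)[OF N(1)] by (intro level_prod_subset) auto
  then show ?thesis ..
qed

lemma L_conj_a: "l \<in> L_T \<Longrightarrow> gen_a \<circ> l \<circ> gen_a \<in> L_T"
  by (rule L_conj_gen) auto

lemma a_conj_a: "gen_a \<circ> (gen_a \<circ> l \<circ> gen_a) \<circ> gen_a = l"
  by (simp add: fun_eq_iff)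

text \<open>Conjugation by (ala, l) acts on the second coordinate as conjugation by l, so
  \<open>L_T\<close> normalises \<open>N\<close>; conjugation by a then puts all of \<open>N\<close>
  times \<open>N\<close> into \<open>H\<close>.\<close>

lemma finite_index_if_rigid_element:
  assumes H: "subgroup H Aut_T" "H \<subseteq> GG" and a: "gen_a \<in> H"
    and diag: "\<And>l. l \<in> L_T \<Longrightarrow> pair l (gen_a \<circ> l \<circ> gen_a) \<in> H"
    and x: "pair id x \<in> H" "x \<noteq> id"
  shows "finite_index_in_G H"
proof -
  define N where "N = {f \<in> tree_auts. at [True] f \<in> H}"
  have N: "subgroup N Aut_T" unfolding N_def by (rule subgroup_at_vimage[OF H(1)])
  have NG: "N \<subseteq> GG" using H(2) pair_in_GD unfolding N_def by auto
  have norm: "l \<circ> n \<circ> finv l \<in> N" if l: "l \<in> L_T" and n: "n \<in> N" for l n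
  proof -
    let ?l = "gen_a \<circ> l \<circ> gen_a"
    have "pair ?l l \<in> H" using diag[OF L_conj_a[OF l]] by (simp only: a_conj_a)
    moreover have "pair id n \<in> H" using n by (simp add: N_def)
    ultimately have "pair ?l l \<circ> pair id n \<circ> finv (pair ?l l) \<in> H"
      using subgroup_Aut_T_D(2,3)[OF H(1)] by blast
    moreover have "pair ?l l \<circ> pair id n \<circ> finv (pair ?l l) = pair id (l \<circ> n \<circ> finv l)"
      using L_bij[OF l] L_bij[OF L_conj_a[OF l]] by (simp only: inv_pair pair_comp comp_id comp_finv)
    moreover have "l \<circ> n \<circ> finv l \<in> tree_auts"
      using n L_tree_auts[OF l] by (simp add: N_def tree_auts_comp tree_auts_inv)
    ultimately show ?thesis by (simp add: N_def)
  qed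
  have "x \<in> tree_auts" using x(1) H(2) pair_in_GD G_tree_auts by blast
  then have "x \<in> N" using x(1) by (simp add: N_def)
  then obtain n where n: "level_prod n K_T \<subseteq> N"
    using level_prod_in_normalized[OF N NG norm _ x(2)] by blast
  have "pair y z \<in> H" if "y \<in> N" "z \<in> N" for y z
  proof -
    have yz: "pair id y \<in> H" "pair id z \<in> H" using that by (simp_all add: N_def)
    have "gen_a \<circ> pair id y \<circ> gen_a \<in> H" using a yz(1) subgroup_Aut_T_D(2)[OF H(1)] by blast
    then have "pair y id \<circ> pair id z \<in> H" unfolding gen_a_pair using yz(2) by (rule subgroup_Aut_T_D(2)[OF H(1)])
    then show ?thesis by (simp add: pair_comp)
  qed
  then have "level_prod (Suc n) K_T \<subseteq> H" using n by auto
  then show ?thesis using finite_index_level_prod[OF finite_index_K] finite_index_in_G_mono by blast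
qed

section \<open>The subgroup \<open>W\<close>\<close>

lemma diag_set_eq: "diag_set = {pair l (gen_a \<circ> l \<circ> gen_a) | l. l \<in> L_T}"
  unfolding diag_set_def L_T_def by simp

lemma finv_diag:
  assumes "bij l"
  shows "finv (pair l (gen_a \<circ> l \<circ> gen_a)) = pair (finv l) (gen_a \<circ> finv l \<circ> gen_a)"
  using assms by (simp add: inv_pair bij_comp tree_auts_bij o_inv_distrib comp_assoc)

lemma bab_eq: "gen_b \<circ> gen_a \<circ> gen_b = pair (gen_a \<circ> gen_c) (gen_a \<circ> (gen_a \<circ> gen_c) \<circ> gen_a) \<circ> gen_a"
proof -
  have "gen_b \<circ> gen_a \<circ> gen_b = gen_b \<circ> (gen_a \<circ> gen_b \<circ> gen_a) \<circ> gen_a" by (simp add: fun_eq_iff)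
  also have "gen_a \<circ> gen_b \<circ> gen_a = pair gen_c gen_a" unfolding gen_pair(1) by (rule gen_a_pair)
  also have "gen_b \<circ> pair gen_c gen_a = pair (gen_a \<circ> gen_c) (gen_a \<circ> (gen_a \<circ> gen_c) \<circ> gen_a)"
    unfolding gen_pair(1) pair_comp pair_inject by (simp add: fun_eq_iff)
  finally show ?thesis .
qed

text \<open>Together with \<open>bab_eq\<close> this relates the three-element generating set to the
  diagonal elements of the two generators b and ac of \<open>L_T\<close>.\<close>

lemma cadab_eq: "gen_c \<circ> gen_a \<circ> gen_d \<circ> gen_a \<circ> gen_b
  = gen_a \<circ> pair gen_b (gen_a \<circ> gen_b \<circ> gen_a) \<circ> gen_a"
proof -
  have "gen_c \<circ> gen_a \<circ> gen_d \<circ> gen_a \<circ> gen_b = gen_c \<circ> (gen_a \<circ> gen_d \<circ> gen_a) \<circ> gen_b"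
    by (simp add: comp_assoc)
  also have "gen_a \<circ> gen_d \<circ> gen_a = pair gen_b id" unfolding gen_pair(3) by (rule gen_a_pair)
  also have "gen_c \<circ> pair gen_b id \<circ> gen_b = pair (gen_a \<circ> gen_b \<circ> gen_a) gen_b"
    using gen_pair(1,2) pair_comp by (metis comp_id gens_comp(5))
  also have "\<dots> = gen_a \<circ> pair gen_b (gen_a \<circ> gen_b \<circ> gen_a) \<circ> gen_a" by (rule gen_a_pair[symmetric])
  finally show ?thesis .
qed

text \<open>The map from l to (l, ala) is a homomorphism, so the generators of \<open>L_T\<close>
  suffice. With \<open>S\<close> arbitrary, the result serves both the containment of
  \<open>W_T\<close> in the group and its description by three generators.\<close>

lemma diag_in_subgroup:
  assumes S: "subgroup S Aut_T"
    and gens: "gen_a \<in> S" "gen_b \<circ> gen_a \<circ> gen_b \<in> S"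
      "gen_c \<circ> gen_a \<circ> gen_d \<circ> gen_a \<circ> gen_b \<in> S"
    and l: "l \<in> L_T"
  shows "pair l (gen_a \<circ> l \<circ> gen_a) \<in> S"
proof -
  note S_comp = subgroup_Aut_T_D(2)[OF S]
  let ?S = "{l \<in> tree_auts. pair l (gen_a \<circ> l \<circ> gen_a) \<in> S}"
  have "L_T \<subseteq> ?S"
    unfolding L_T_def
  proof (rule generate_Aut_T_subset)
    have "pair (gen_a \<circ> gen_c) (gen_a \<circ> (gen_a \<circ> gen_c) \<circ> gen_a) \<in> S"
      using S_comp[OF gens(2,1)] unfolding bab_eq by (simp add: comp_assoc)
    moreover have "pair gen_b (gen_a \<circ> gen_b \<circ> gen_a) \<in> S"
      using S_comp[OF S_comp[OF gens(1,3)] gens(1)] unfolding cadab_eq a_conj_a .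
    ultimately show "{gen_b, gen_a \<circ> gen_c} \<subseteq> ?S" by (simp add: tree_auts_comp)
    show "subgroup ?S Aut_T"
      unfolding subgroup_Aut_T_iff
    proof (intro conjI ballI)
      fix f g assume fg: "f \<in> ?S" "g \<in> ?S"
      then have "pair f (gen_a \<circ> f \<circ> gen_a) \<circ> pair g (gen_a \<circ> g \<circ> gen_a) \<in> S"
        using S_comp by blast
      moreover have "(gen_a \<circ> f \<circ> gen_a) \<circ> (gen_a \<circ> g \<circ> gen_a) = gen_a \<circ> (f \<circ> g) \<circ> gen_a"
        by (simp add: fun_eq_iff)
      ultimately show "f \<circ> g \<in> ?S" using fg by (simp add: pair_comp tree_auts_comp)
    next
      fix f assume f: "f \<in> ?S"
      then have "finv (pair f (gen_a \<circ> f \<circ> gen_a)) = pair (finv f) (gen_a \<circ> finv f \<circ> gen_a)"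
        by (simp add: finv_diag tree_auts_bij)
      then show "finv f \<in> ?S" using f subgroup_Aut_T_D(3)[OF S] tree_auts_inv
        unfolding mem_Collect_eq by metis
    next
      show "id \<in> ?S" using subgroup_Aut_T_D(1)[OF S] by simp
    qed auto
  qed
  then show ?thesis using l by auto
qed

lemma diag_in_G: "l \<in> L_T \<Longrightarrow> pair l (gen_a \<circ> l \<circ> gen_a) \<in> GG"
  by (rule diag_in_subgroup[OF subgroup_G]) (intro G_comp gens_in_G)+

lemma W_gens_tree_auts: "insert gen_a diag_set \<subseteq> tree_auts"
  using diag_in_G G_tree_auts by (auto simp: diag_set_eq)

lemma subgroup_W: "subgroup W_T Aut_T"
  unfolding W_T_def by (rule Aut_T.generate_is_subgroup) (use W_gens_tree_auts in simp)

lemma a_in_W: "gen_a \<in> W_T" and diag_in_W: "l \<in> L_T \<Longrightarrow> pair l (gen_a \<circ> l \<circ> gen_a) \<in> W_T"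
  unfolding W_T_def by (auto intro!: generate.incl simp: diag_set_eq)

lemma W_subset_G: "W_T \<subseteq> GG"
  unfolding W_T_def
  by (rule generate_Aut_T_subset[OF _ subgroup_G]) (use diag_in_G in \<open>auto simp: diag_set_eq\<close>)

text \<open>\<open>gen_a\<close> normalises the diagonal subgroup: conjugation turns (l, ala) into
  (ala, l), the diagonal element of ala.\<close>

lemma W_cases:
  assumes "g \<in> W_T"
  shows "\<exists>l\<in>L_T. g = pair l (gen_a \<circ> l \<circ> gen_a) \<or> g = pair l (gen_a \<circ> l \<circ> gen_a) \<circ> gen_a"
  using assms[unfolded W_T_def]
proof (induction rule: generate_Aut_T_induct)
  case (finv x)
  then consider "x = gen_a" | l where "l \<in> L_T" "x = pair l (gen_a \<circ> l \<circ> gen_a)"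
    unfolding diag_set_eq by blast
  then have "finv x \<in> insert gen_a diag_set"
  proof cases
    case 2
    then show ?thesis unfolding diag_set_eq 2(2) finv_diag[OF L_bij[OF 2(1)]] using L_finv by blast
  qed simp
  then show ?case using W_gens_tree_auts finv by blast
next
  case id
  have "id = pair id (gen_a \<circ> id \<circ> gen_a)" by simp
  then show ?case using L_id by blast
next
  case (step x g)
  then obtain l where l: "l \<in> L_T"
    "g = pair l (gen_a \<circ> l \<circ> gen_a) \<or> g = pair l (gen_a \<circ> l \<circ> gen_a) \<circ> gen_a" by blast
  from step(1) consider "x = gen_a" | k where "k \<in> L_T" "x = pair k (gen_a \<circ> k \<circ> gen_a)"
    unfolding diag_set_eq by blast
  then show ?case
  proof cases
    case 1
    let ?l = "gen_a \<circ> l \<circ> gen_a"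
    have "gen_a \<circ> pair l ?l = pair ?l (gen_a \<circ> ?l \<circ> gen_a) \<circ> gen_a"
      by (simp only: a_conj_a[of l] pair_gen_a)
    moreover have "gen_a \<circ> (pair l ?l \<circ> gen_a) = pair ?l (gen_a \<circ> ?l \<circ> gen_a)"
      unfolding a_conj_a[of l] using gen_a_pair[of l ?l] by (simp only: comp_assoc)
    ultimately show ?thesis using 1 l L_conj_a[OF l(1)] by metis
  next
    case 2
    have "x \<circ> pair l (gen_a \<circ> l \<circ> gen_a) = pair (k \<circ> l) (gen_a \<circ> (k \<circ> l) \<circ> gen_a)"
      unfolding 2(2) pair_comp pair_inject by (simp add: fun_eq_iff)
    then show ?thesis using l(2) L_comp[OF 2(1) l(1)] by (metis comp_assoc)
  qed
qed

lemma pair_in_W_iff: "pair x y \<in> W_T \<longleftrightarrow> x \<in> L_T \<and> y = gen_a \<circ> x \<circ> gen_a"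
  using W_cases diag_in_W pair_inject pair_neq_swap by metis

lemma level_transitive_W: "level_transitive W_T"
  unfolding level_transitive_def
proof (intro allI impI)
  fix n and u v :: "bool list" assume len: "length u = n" "length v = n"
  show "\<exists>h\<in>W_T. h u = v"
  proof (cases "u = []")
    case True
    then show ?thesis using len subgroup_Aut_T_D(1)[OF subgroup_W] by (intro bexI[of _ id]) auto
  next
    case False
    then obtain i u' j v' where uv: "u = i # u'" "v = j # v'" "length u' = length v'"
      using len by (cases u; cases v) auto
    have "\<exists>l\<in>L_T. l u' = v'"
    proof (cases "u' = []")
      case True
      then show ?thesis using uv(3) L_id by (intro bexI[of _ id]) auto
    next
      case False
      then show ?thesis using L_move[OF uv(3) False G_id] by (metis append_Nil2 id_apply)
    qed
    then obtain l where l: "l \<in> L_T" "l u' = v'" by blast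
    \<comment> \<open>Chosen so that the coordinate acting below the letter \<open>i\<close> is
      \<open>l\<close>; the first letter is corrected afterwards by \<open>gen_a\<close>.\<close>
    define k where "k = (if i then gen_a \<circ> l \<circ> gen_a else l)"
    define g where "g = pair k (gen_a \<circ> k \<circ> gen_a)"
    have "g \<in> W_T"
      unfolding g_def k_def using l(1) L_conj_a[OF l(1)] by (intro diag_in_W) simp
    moreover from this have "gen_a \<circ> g \<in> W_T" by (rule subgroup_Aut_T_D(2)[OF subgroup_W a_in_W])
    moreover have "g u = i # v'"
      using l(2) by (cases i) (simp_all add: uv g_def k_def)
    moreover from this have "(gen_a \<circ> g) u = (\<not> i) # v'" by simp
    moreover have "v = i # v' \<or> v = (\<not> i) # v'" using uv(2) by auto
    ultimately show ?thesis by metis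
  qed
qed

lemma W_generators:
  "W_T = generate Aut_T {gen_a, gen_b \<circ> gen_a \<circ> gen_b, gen_c \<circ> gen_a \<circ> gen_d \<circ> gen_a \<circ> gen_b}"
    (is "_ = generate Aut_T ?X")
proof
  note W_comp = subgroup_Aut_T_D(2)[OF subgroup_W]
  show "generate Aut_T ?X \<subseteq> W_T"
  proof (rule generate_Aut_T_subset[OF _ subgroup_W])
    have "gen_b \<circ> gen_a \<circ> gen_b \<in> W_T"
      unfolding bab_eq by (intro W_comp diag_in_W ac_in_L a_in_W)
    moreover have "gen_c \<circ> gen_a \<circ> gen_d \<circ> gen_a \<circ> gen_b \<in> W_T"
      unfolding cadab_eq by (intro W_comp diag_in_W b_in_L a_in_W)
    ultimately show "?X \<subseteq> W_T" using a_in_W by simp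
  qed
  have "?X \<subseteq> carrier Aut_T" by (simp add: tree_auts_comp)
  note sub = Aut_T.generate_is_subgroup[OF this]
  have X: "gen_a \<in> generate Aut_T ?X" "gen_b \<circ> gen_a \<circ> gen_b \<in> generate Aut_T ?X"
    "gen_c \<circ> gen_a \<circ> gen_d \<circ> gen_a \<circ> gen_b \<in> generate Aut_T ?X"
    by (auto intro: generate.incl)
  show "W_T \<subseteq> generate Aut_T ?X"
    unfolding W_T_def
    by (rule generate_Aut_T_subset[OF _ sub]) (use X diag_in_subgroup[OF sub X] in \<open>auto simp: diag_set_eq\<close>)
qed

section \<open>Cosets, index and weak maximality\<close>

lemma subgroup_Grigorchuk_iff: "subgroup H Grigorchuk \<longleftrightarrow> subgroup H Aut_T \<and> H \<subseteq> GG"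
  unfolding Grigorchuk_def by (rule Aut_T.subgroup_subgroup_generated_iff)

lemma r_coset_Grigorchuk: "H #>\<^bsub>Grigorchuk\<^esub> g = (\<lambda>h. h \<circ> g) ` H"
  unfolding r_coset_def Grigorchuk_def by auto

text \<open>If g = sr with s in \<open>H\<close>, the coset of g is the set of all
  \<open>h \<circ> r\<close>; this makes sense even for r outside the group.\<close>

lemma finite_rcosets:
  assumes H: "subgroup H Aut_T" and fi: "finite_index_in_G H"
  shows "finite (rcosets\<^bsub>Grigorchuk\<^esub> H)"
proof -
  obtain R where R: "finite R" "\<And>g. g \<in> GG \<Longrightarrow> \<exists>s\<in>H. \<exists>r\<in>R. g = s \<circ> r"
    using fi unfolding finite_index_in_G_def by blast
  have "rcosets\<^bsub>Grigorchuk\<^esub> H \<subseteq> (\<lambda>r. (\<lambda>h. h \<circ> r) ` H) ` R"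
  proof
    fix C assume "C \<in> rcosets\<^bsub>Grigorchuk\<^esub> H"
    then obtain g where g: "g \<in> GG" "C = (\<lambda>h. h \<circ> g) ` H"
      unfolding RCOSETS_def r_coset_Grigorchuk by blast
    obtain s r where sr: "s \<in> H" "r \<in> R" "g = s \<circ> r" using R(2)[OF g(1)] by blast
    have "(\<lambda>h. h \<circ> g) ` H = (\<lambda>h. h \<circ> r) ` H"
    proof
      show "(\<lambda>h. h \<circ> g) ` H \<subseteq> (\<lambda>h. h \<circ> r) ` H"
        using subgroup_Aut_T_D(2)[OF H _ sr(1)] by (auto simp: sr(3) comp_assoc[symmetric])
      show "(\<lambda>h. h \<circ> r) ` H \<subseteq> (\<lambda>h. h \<circ> g) ` H"
      proof
        fix f assume "f \<in> (\<lambda>h. h \<circ> r) ` H"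
        then obtain h where h: "h \<in> H" "f = h \<circ> r" by blast
        have "f = (h \<circ> finv s) \<circ> g"
          using bij_inv_apply(2)[OF subgroup_Aut_T_D(5)[OF H sr(1)]] by (simp add: h(2) sr(3) fun_eq_iff)
        then show "f \<in> (\<lambda>h. h \<circ> g) ` H"
          using subgroup_Aut_T_D(2,3)[OF H] h(1) sr(1) by blast
      qed
    qed
    then show "C \<in> (\<lambda>r. (\<lambda>h. h \<circ> r) ` H) ` R" using g(2) sr(2) by blast
  qed
  then show ?thesis by (rule finite_surj[OF R(1)])
qed

text \<open>The elements (k, 1) with k in \<open>K_T\<close> lie in distinct cosets, since an
  element (m, 1) of \<open>W_T\<close> satisfies ama = 1.\<close>

lemma infinite_rcosets_W: "infinite (rcosets\<^bsub>Grigorchuk\<^esub> W_T)"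
proof
  assume fin: "finite (rcosets\<^bsub>Grigorchuk\<^esub> W_T)"
  let ?c = "\<lambda>k. W_T #>\<^bsub>Grigorchuk\<^esub> pair k id"
  have "pair k id \<in> GG" if "k \<in> K_T" for k
    using at_in_K[OF that, of "[False]"] K_subset_G by auto
  then have "?c ` K_T \<subseteq> rcosets\<^bsub>Grigorchuk\<^esub> W_T" unfolding RCOSETS_def by auto
  moreover have "inj_on ?c K_T"
  proof (rule inj_onI)
    fix x y assume x: "x \<in> K_T" and y: "y \<in> K_T" and eq: "?c x = ?c y"
    have "pair x id \<in> ?c x"
      unfolding r_coset_Grigorchuk using subgroup_Aut_T_D(1)[OF subgroup_W] by (metis id_comp image_eqI)
    then have "pair x id \<in> (\<lambda>h. h \<circ> pair y id) ` W_T" unfolding eq unfolding r_coset_Grigorchuk .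
    then obtain w where w: "w \<in> W_T" "pair x id = w \<circ> pair y id" by (elim imageE)
    have "w = w \<circ> pair y id \<circ> pair (finv y) id"
      by (simp add: comp_assoc pair_comp comp_finv(1)[OF K_bij[OF y]])
    also have "\<dots> = pair (x \<circ> finv y) id" by (simp add: w(2)[symmetric] pair_comp)
    finally have "gen_a \<circ> (x \<circ> finv y) \<circ> gen_a = id" using w(1) pair_in_W_iff by metis
    then have "x \<circ> finv y = id" using a_conj_a[of "x \<circ> finv y"] by simp
    then show "x = y" using comp_finv(2)[OF K_bij[OF y]] by (metis comp_assoc comp_id id_comp)
  qed
  ultimately show False using fin infinite_K inj_on_finite by blast
qed

lemma rigid_element:
  assumes H: "subgroup H Aut_T" "H \<subseteq> GG" and W: "W_T \<subset> H"
  shows "\<exists>x. x \<noteq> id \<and> pair id x \<in> H"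
proof -
  note H_comp = subgroup_Aut_T_D(2)[OF H(1)] and H_finv = subgroup_Aut_T_D(3)[OF H(1)]
  have diag: "pair l (gen_a \<circ> l \<circ> gen_a) \<in> H" if "l \<in> L_T" for l
    using diag_in_W[OF that] W by blast
  obtain h where h: "h \<in> H" "h \<notin> W_T" using W by blast
  then obtain h0 h1 where h01: "h0 \<in> GG" "h1 \<in> GG" "h = pair h0 h1 \<or> h = pair h0 h1 \<circ> gen_a"
    using H(2) G_pair_cases by blast
  have h': "pair h0 h1 \<in> H" "pair h0 h1 \<notin> W_T"
  proof -
    have "pair h0 h1 \<circ> gen_a \<circ> gen_a = pair h0 h1" by (simp add: comp_assoc)
    then have "pair h0 h1 = h \<or> pair h0 h1 = h \<circ> gen_a" using h01(3) by auto
    moreover have "h \<circ> gen_a \<in> H" using h(1) a_in_W W by (intro H_comp) auto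
    ultimately show "pair h0 h1 \<in> H" using h(1) by auto
    show "pair h0 h1 \<notin> W_T"
      using h(2) h01(3) subgroup_Aut_T_D(2)[OF subgroup_W _ a_in_W] by blast
  qed
  show ?thesis
  proof (cases "h0 \<in> L_T")
    case True
    \<comment> \<open>Cancelling the first coordinate by a diagonal element leaves (1, x), and x = 1
      would put (h0, h1) into \<open>W_T\<close>.\<close>
    let ?x = "gen_a \<circ> finv h0 \<circ> gen_a \<circ> h1"
    have "pair (finv h0) (gen_a \<circ> finv h0 \<circ> gen_a) \<circ> pair h0 h1 \<in> H"
      using diag[OF L_finv[OF True]] h'(1) by (rule H_comp)
    then have "pair id ?x \<in> H" by (simp add: pair_comp comp_finv(2)[OF L_bij[OF True]])
    moreover have "?x \<noteq> id"
    proof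
      assume "?x = id"
      then have "(gen_a \<circ> h0 \<circ> gen_a) \<circ> ?x = gen_a \<circ> h0 \<circ> gen_a" by simp
      then have "h1 = gen_a \<circ> h0 \<circ> gen_a"
        by (simp add: fun_eq_iff bij_inv_apply(1)[OF L_bij[OF True]])
      then show False using h'(2) True pair_in_W_iff by blast
    qed
    ultimately show ?thesis by blast
  next
    case False
    define l where "l = gen_a \<circ> h0"
    have l: "l \<in> L_T" using G_eq_L_cosets[OF h01(1)] False unfolding l_def by blast
    have h0: "h0 = gen_a \<circ> l" unfolding l_def by (simp add: fun_eq_iff)
    define y where "y = h1 \<circ> (gen_a \<circ> finv l \<circ> gen_a)"
    have "pair h0 h1 \<circ> pair (finv l) (gen_a \<circ> finv l \<circ> gen_a) \<in> H"
      using h'(1) diag[OF L_finv[OF l]] by (rule H_comp)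
    then have ay: "pair gen_a y \<in> H"
      by (simp add: pair_comp h0 y_def comp_assoc comp_finv(1)[OF L_bij[OF l]])
    have yG: "y \<in> GG" using ay H(2) pair_in_GD by blast
    define z where "z = y \<circ> gen_a"
    \<comment> \<open>This is where the parity argument enters: it makes \<open>z\<close>
      nontrivial, so that some \<open>g\<close> in \<open>L_T\<close> fails to commute with
      it.\<close>
    have "y \<noteq> gen_a" using ay H(2) pair_a_a_notin_G by blast
    moreover have "y = z \<circ> gen_a" unfolding z_def by (simp add: fun_eq_iff)
    ultimately have "z \<noteq> id" by auto
    moreover have zG: "z \<in> GG" unfolding z_def by (intro G_comp yG gens_in_G)
    ultimately obtain g where g: "g \<in> L_T" "g \<circ> z \<noteq> z \<circ> g" using L_centralizer_trivial by blast
    \<comment> \<open>The first coordinate of the commutator of \<open>p\<close> with (a, y). As it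
      lies in \<open>L_T\<close>, dividing by its diagonal element \<open>q\<close> leaves (1, x)
      with x the commutator of \<open>g\<close> and \<open>z\<close>.\<close>
    define k where "k = g \<circ> (gen_a \<circ> finv g \<circ> gen_a)"
    have k: "k \<in> L_T" unfolding k_def by (intro L_comp g(1) L_conj_a L_finv)
    define p where "p = pair g (gen_a \<circ> g \<circ> gen_a)"
    define q where "q = pair k (gen_a \<circ> k \<circ> gen_a)"
    define x where "x = g \<circ> z \<circ> finv g \<circ> finv z"
    note inv_y = inv_pair[OF G_bij[OF gens_in_G(1)] G_bij[OF yG]]
    have finv_z: "finv z = gen_a \<circ> finv y"
      unfolding z_def using o_inv_distrib[OF G_bij[OF yG] G_bij[OF gens_in_G(1)]] by simp
    have "p \<circ> pair gen_a y \<circ> finv p \<circ> finv (pair gen_a y) = q \<circ> pair id x"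
      unfolding p_def q_def x_def finv_z finv_diag[OF L_bij[OF g(1)]] inv_y pair_comp pair_inject
      by (simp add: k_def z_def fun_eq_iff bij_inv_apply(2)[OF L_bij[OF g(1)]])
    moreover have "p \<in> H" "q \<in> H" unfolding p_def q_def by (rule diag[OF g(1)], rule diag[OF k])
    ultimately have "q \<circ> pair id x \<in> H" using ay H_comp H_finv by metis
    then have "finv q \<circ> (q \<circ> pair id x) \<in> H" using \<open>q \<in> H\<close> H_comp H_finv by blast
    then have "pair id x \<in> H"
      using comp_finv(2)[OF subgroup_Aut_T_D(5)[OF H(1) \<open>q \<in> H\<close>]] by (simp add: comp_assoc[symmetric])
    moreover have "x \<noteq> id"
    proof
      assume "x = id"
      then have "x \<circ> (z \<circ> g) = z \<circ> g" by simp
      then have "g \<circ> z = z \<circ> g"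
        by (simp add: x_def fun_eq_iff bij_inv_apply(2)[OF G_bij[OF zG]] bij_inv_apply(2)[OF L_bij[OF g(1)]])
      then show False using g(2) by simp
    qed
    ultimately show ?thesis by blast
  qed
qed

lemma weakly_maximal_W: "weakly_maximal Grigorchuk W_T"
  unfolding weakly_maximal_def
proof (intro conjI allI impI)
  show "subgroup W_T Grigorchuk" using subgroup_W W_subset_G by (simp add: subgroup_Grigorchuk_iff)
  show "infinite (rcosets\<^bsub>Grigorchuk\<^esub> W_T)" by (rule infinite_rcosets_W)
  fix H assume "subgroup H Grigorchuk" and inf: "infinite (rcosets\<^bsub>Grigorchuk\<^esub> H)" and W: "W_T \<subseteq> H"
  then have H: "subgroup H Aut_T" "H \<subseteq> GG" by (simp_all add: subgroup_Grigorchuk_iff)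
  show "H = W_T"
  proof (rule ccontr)
    assume "H \<noteq> W_T"
    then obtain x where "x \<noteq> id" "pair id x \<in> H" using rigid_element[OF H] W by blast
    then have "finite_index_in_G H"
      using W a_in_W diag_in_W by (intro finite_index_if_rigid_element[OF H]) auto
    then show False using finite_rcosets[OF H(1)] inf by blast
  qed
qed

theorem lemma7p4:
  shows "W_T = generate Aut_T {gen_a, gen_b \<otimes>\<^bsub>Aut_T\<^esub> gen_a \<otimes>\<^bsub>Aut_T\<^esub> gen_b,
           gen_c \<otimes>\<^bsub>Aut_T\<^esub> gen_a \<otimes>\<^bsub>Aut_T\<^esub> gen_d \<otimes>\<^bsub>Aut_T\<^esub> gen_a \<otimes>\<^bsub>Aut_T\<^esub> gen_b}
         \<and> level_transitive W_T \<and> weakly_maximal Grigorchuk W_T"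
  using W_generators level_transitive_W weakly_maximal_W by simp

end
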